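(* Let $G$ be a finite group, $p$ a prime, and $n \ge 2$ an integer. For $\phi \in \mathrm{Irr}(G)$ define \[ \gamma_n(\phi) = \sum_{\chi_1,\dots,\chi_n \in \mathrm{Irr}(G)} \Big[\phi,\ \prod_{i=1}^{n}\chi_i\overline{\chi_i}\Big], \qquad \delta_n(\phi) = \sum_{\chi_1,\dots,\chi_n \in \mathrm{Irr}(G)} \Big[\phi,\ \prod_{i=1}^{n}\chi_i^{2}\Big]. \] Then: (1) $G$ has a conjugacy class of $p$-defect $0$ if and only if there exists $\phi \in \mathrm{Irr}(G)$ such that $\gamma_n(\phi)$ is not divisible by $p$. (2) $G$ has a real conjugacy class of $p$-defect $0$ if and only if there exists $\phi \in \mathrm{Irr}(G)$ such that $\delta_n(\phi)$ is not divisible by $p$.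
   Context: $\mathrm{Irr}(G)$ is the set of irreducible complex characters of $G$, $\overline{\chi}$ is the complex conjugate character, and $[\alpha,\beta] = \frac{1}{|G|}\sum_{g\in G}\alpha(g)\overline{\beta(g)}$ is the usual inner product of class functions; the sums run over all $n$-tuples of irreducible characters (repetition allowed). A conjugacy class $K$ of $G$ has $p$-defect $0$ if $|K|_p = |G|_p$, where $m_p$ denotes the largest power of $p$ dividing the integer $m$. A conjugacy class $K$ is real if $K = K^{-1} = \{g^{-1} : g\in K\}$. *)

theory Defs
  imports "HOL-Computational_Algebra.Primes" "HOL-Algebra.Group" "Jordan_Normal_Form.Matrix"
begin

definition is_rep :: "('a, 'b) monoid_scheme \<Rightarrow> nat \<Rightarrow> ('a \<Rightarrow> complex mat) \<Rightarrow> bool" where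
  "is_rep G d \<rho> \<longleftrightarrow>
     (\<forall>g \<in> carrier G. \<rho> g \<in> carrier_mat d d) \<and>
     \<rho> \<one>\<^bsub>G\<^esub> = 1\<^sub>m d \<and>
     (\<forall>g \<in> carrier G. \<forall>h \<in> carrier G. \<rho> (g \<otimes>\<^bsub>G\<^esub> h) = \<rho> g * \<rho> h)"

definition is_subspace :: "nat \<Rightarrow> complex vec set \<Rightarrow> bool" where
  "is_subspace d W \<longleftrightarrow> W \<subseteq> carrier_vec d \<and> 0\<^sub>v d \<in> W \<and>
     (\<forall>v \<in> W. \<forall>w \<in> W. v + w \<in> W) \<and> (\<forall>c. \<forall>v \<in> W. c \<cdot>\<^sub>v v \<in> W)"

definition is_irr_rep :: "('a, 'b) monoid_scheme \<Rightarrow> nat \<Rightarrow> ('a \<Rightarrow> complex mat) \<Rightarrow> bool" where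
  "is_irr_rep G d \<rho> \<longleftrightarrow> is_rep G d \<rho> \<and> d > 0 \<and>
     (\<forall>W. is_subspace d W \<and> (\<forall>g \<in> carrier G. \<forall>w \<in> W. \<rho> g *\<^sub>v w \<in> W)
        \<longrightarrow> W = {0\<^sub>v d} \<or> W = carrier_vec d)"

definition mat_trace :: "complex mat \<Rightarrow> complex" where
  "mat_trace A = (\<Sum>i<dim_row A. A $$ (i, i))"

definition character :: "('a, 'b) monoid_scheme \<Rightarrow> ('a \<Rightarrow> complex mat) \<Rightarrow> 'a \<Rightarrow> complex" where
  "character G \<rho> = (\<lambda>g. if g \<in> carrier G then mat_trace (\<rho> g) else 0)"

definition Irr :: "('a, 'b) monoid_scheme \<Rightarrow> ('a \<Rightarrow> complex) set" where
  "Irr G = {\<chi>. \<exists>d \<rho>. is_irr_rep G d \<rho> \<and> \<chi> = character G \<rho>}"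

definition cf_inner :: "('a, 'b) monoid_scheme \<Rightarrow> ('a \<Rightarrow> complex) \<Rightarrow> ('a \<Rightarrow> complex) \<Rightarrow> complex" where
  "cf_inner G \<alpha> \<beta> = (\<Sum>g \<in> carrier G. \<alpha> g * cnj (\<beta> g)) / of_nat (card (carrier G))"

definition gamma_n :: "('a, 'b) monoid_scheme \<Rightarrow> nat \<Rightarrow> ('a \<Rightarrow> complex) \<Rightarrow> complex" where
  "gamma_n G n \<phi> = (\<Sum>\<chi> \<in> Pi\<^sub>E {..<n} (\<lambda>_. Irr G).
      cf_inner G \<phi> (\<lambda>g. \<Prod>i<n. \<chi> i g * cnj (\<chi> i g)))"

definition delta_n :: "('a, 'b) monoid_scheme \<Rightarrow> nat \<Rightarrow> ('a \<Rightarrow> complex) \<Rightarrow> complex" where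
  "delta_n G n \<phi> = (\<Sum>\<chi> \<in> Pi\<^sub>E {..<n} (\<lambda>_. Irr G).
      cf_inner G \<phi> (\<lambda>g. \<Prod>i<n. (\<chi> i g)^2))"

definition conj_class :: "('a, 'b) monoid_scheme \<Rightarrow> 'a \<Rightarrow> 'a set" where
  "conj_class G g = {h \<otimes>\<^bsub>G\<^esub> g \<otimes>\<^bsub>G\<^esub> inv\<^bsub>G\<^esub> h | h. h \<in> carrier G}"

definition is_conj_class :: "('a, 'b) monoid_scheme \<Rightarrow> 'a set \<Rightarrow> bool" where
  "is_conj_class G K \<longleftrightarrow> (\<exists>g \<in> carrier G. K = conj_class G g)"

definition p_part :: "nat \<Rightarrow> nat \<Rightarrow> nat" where
  "p_part p m = p ^ multiplicity p m"

definition p_defect_zero :: "('a, 'b) monoid_scheme \<Rightarrow> nat \<Rightarrow> 'a set \<Rightarrow> bool" where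
  "p_defect_zero G p K \<longleftrightarrow> p_part p (card K) = p_part p (card (carrier G))"

definition real_class :: "('a, 'b) monoid_scheme \<Rightarrow> 'a set \<Rightarrow> bool" where
  "real_class G K \<longleftrightarrow> (\<lambda>x. inv\<^bsub>G\<^esub> x) ` K = K"

definition not_div_by :: "nat \<Rightarrow> complex \<Rightarrow> bool" where
  "not_div_by p z \<longleftrightarrow> \<not> (\<exists>m::int. z = of_int (int p * m))"

end

theory Submission
  imports Defs "Jordan_Normal_Form.Spectral_Radius" "Jordan_Normal_Form.Matrix_Kernel"
    "HOL-Algebra.Multiplicative_Group" "HOL-Algebra.Group_Action"
begin

text \<open>By column orthogonality \<open>\<Sum>\<^sub>\<chi> \<chi>(g) \<chi>(g)\<^sup>*\<close> is the order of the centralizer \<open>C(g)\<close>, and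
  \<open>\<Sum>\<^sub>\<chi> \<chi>(g)\<^sup>2\<close> is \<open>|C(g)|\<close> if \<open>g\<close> is real and 0 otherwise. Hence both invariants have the form
  \<open>F(\<phi>) = [\<phi>, w\<^sup>n]\<close> where \<open>w\<close> is \<open>|C(g)|\<close> on the classes with a property \<open>Q\<close> and 0 elsewhere, and
  \<open>F(\<phi>)\<close> is an integer because it is a sum of multiplicities.
  The class of \<open>g\<close> has \<open>p\<close>-defect 0 iff \<open>p\<close> does not divide \<open>|C(g)|\<close>.
  If \<open>p\<close> divides \<open>|C(g)|\<close> for all \<open>g\<close> with \<open>Q\<close>, then \<open>F(\<phi>) / p = \<Sum>\<^sub>K \<phi>(g\<^sub>K) |C(g\<^sub>K)|\<^sup>n\<^sup>-\<^sup>1 / p\<close>, summed over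
  the classes \<open>K\<close> with \<open>Q\<close>, is a rational algebraic integer and thus an integer. Conversely,
  \<open>w(h)\<^sup>n = \<Sum>\<^sub>\<phi> F(\<phi>) \<phi>(h)\<close>, so if \<open>p\<close> divides every \<open>F(\<phi>)\<close> then \<open>|C(h)|\<^sup>n / p\<close> is a rational algebraic
  integer for every \<open>h\<close> with \<open>Q\<close>, and \<open>p\<close> divides \<open>|C(h)|\<close>.\<close>

section \<open>Matrices\<close>

lemma index_mult_mat_sum:
  assumes "A \<in> carrier_mat m n" "B \<in> carrier_mat n l" "i < m" "j < l"
  shows "(A * B) $$ (i, j) = (\<Sum>k<n. A $$ (i, k) * B $$ (k, j))"
  using assms by (simp add: scalar_prod_def atLeast0LessThan)

lemma mult_mat_unit_vec:
  fixes A :: "'a :: comm_semiring_1 mat"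
  assumes A: "A \<in> carrier_mat m n" and j: "j < n"
  shows "A *\<^sub>v unit_vec n j = col A j"
  using col_mult2[OF A one_carrier_mat j] A j by simp

lemma mult_mat_zero_vec:
  fixes A :: "'a :: semiring_0 mat"
  assumes "A \<in> carrier_mat m n"
  shows "A *\<^sub>v 0\<^sub>v n = 0\<^sub>v m"
  using assms by (intro eq_vecI) auto

lemma eq_mat_if_mult_vec_eq:
  fixes A B :: "'a :: comm_semiring_1 mat"
  assumes "A \<in> carrier_mat m n" "B \<in> carrier_mat m n"
    and "\<And>v. v \<in> carrier_vec n \<Longrightarrow> A *\<^sub>v v = B *\<^sub>v v"
  shows "A = B"
proof (rule mat_col_eqI)
  fix j assume "j < dim_col B"
  hence "j < n" using assms(2) by simp
  thus "col A j = col B j"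
    using assms by (simp flip: mult_mat_unit_vec)
qed (use assms in auto)

lemma two_sided_inverse_if_bij_betw:
  fixes T :: "'a :: comm_ring_1 mat"
  assumes T: "T \<in> carrier_mat m n"
    and bij: "bij_betw ((*\<^sub>v) T) (carrier_vec n) (carrier_vec m)"
  obtains S where "S \<in> carrier_mat n m" "T * S = 1\<^sub>m m" "S * T = 1\<^sub>m n"
proof -
  have "\<exists>v\<in>carrier_vec n. T *\<^sub>v v = unit_vec m j" for j
    using bij_betw_imp_surj_on[OF bij] by (metis image_iff unit_vec_carrier)
  then obtain s where s: "\<And>j. s j \<in> carrier_vec n" "\<And>j. T *\<^sub>v s j = unit_vec m j" by metis
  define S where "S = mat_of_cols n (map s [0..<m])"
  have S: "S \<in> carrier_mat n m" using mat_of_cols_carrier(1)[of n "map s [0..<m]"] by (simp add: S_def)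
  have TS: "T * S = 1\<^sub>m m"
  proof (rule mat_col_eqI)
    fix j assume "j < dim_col (1\<^sub>m m :: 'a mat)"
    thus "col (T * S) j = col (1\<^sub>m m) j"
      using s by (simp add: col_mult2[OF T S]) (simp add: S_def)
  qed (use T S in auto)
  have "S * T = 1\<^sub>m n"
  proof (rule eq_mat_if_mult_vec_eq)
    fix v :: "'a vec" assume v: "v \<in> carrier_vec n"
    have "T *\<^sub>v ((S * T) *\<^sub>v v) = (T * S) *\<^sub>v (T *\<^sub>v v)" using T S v by simp
    also have "\<dots> = T *\<^sub>v v" using T v by (simp add: TS)
    finally have "(S * T) *\<^sub>v v = v"
      using inj_onD[OF bij_betw_imp_inj_on[OF bij]] S T v by simp
    thus "(S * T) *\<^sub>v v = 1\<^sub>m n *\<^sub>v v" using v by simp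
  qed (use S T in auto)
  thus thesis using that S TS by blast
qed

lemma two_sided_inverse_if_det_nonzero:
  fixes P :: "'a :: field mat"
  assumes "P \<in> carrier_mat n n" "det P \<noteq> 0"
  obtains Q where "Q \<in> carrier_mat n n" "P * Q = 1\<^sub>m n" "Q * P = 1\<^sub>m n"
  using det_non_zero_imp_unit[OF assms, of "()"] unfolding Units_def ring_mat_def by auto

lemma four_block_mat_eqD:
  assumes eq: "four_block_mat A B C D = four_block_mat A' B' C' D'"
    and A: "A \<in> carrier_mat m n" "A' \<in> carrier_mat m n"
    and D: "D \<in> carrier_mat k l" "D' \<in> carrier_mat k l"
  shows "A = A'" and "D = D'"
proof -
  show "A = A'"
  proof (rule eq_matI)
    fix i j assume "i < dim_row A'" "j < dim_col A'"
    thus "A $$ (i, j) = A' $$ (i, j)"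
      using arg_cong[OF eq, of "\<lambda>M. M $$ (i, j)"] A D by simp
  qed (use A in auto)
  show "D = D'"
  proof (rule eq_matI)
    fix i j assume "i < dim_row D'" "j < dim_col D'"
    thus "D $$ (i, j) = D' $$ (i, j)"
      using arg_cong[OF eq, of "\<lambda>M. M $$ (m + i, n + j)"] A D by simp
  qed (use D in auto)
qed

lemma upper_triangular_mult:
  fixes A B :: "'a :: semiring_0 mat"
  assumes A: "A \<in> carrier_mat n n" "upper_triangular A"
    and B: "B \<in> carrier_mat n n" "upper_triangular B"
  shows "upper_triangular (A * B)"
    and "i < n \<Longrightarrow> (A * B) $$ (i, i) = A $$ (i, i) * B $$ (i, i)"
proof -
  have zero: "A $$ (i, k) * B $$ (k, j) = 0" if "j \<le> i" "i < n" "k < n" "k \<noteq> i \<or> k \<noteq> j" for i j k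
    using that upper_triangularD[OF A(2), of k i] upper_triangularD[OF B(2), of j k] A B
    by (cases "k < i") auto
  show "upper_triangular (A * B)"
  proof (rule upper_triangularI)
    fix i j assume "j < i" "i < dim_row (A * B)"
    hence "j < i" "i < n" using A by auto
    thus "(A * B) $$ (i, j) = 0" by (simp add: index_mult_mat_sum[OF A(1) B(1)] zero del: index_mult_mat)
  qed
  show "(A * B) $$ (i, i) = A $$ (i, i) * B $$ (i, i)" if "i < n"
  proof -
    have "(\<Sum>k<n. A $$ (i, k) * B $$ (k, i)) = (\<Sum>k\<in>{i}. A $$ (i, k) * B $$ (k, i))"
      by (rule sum.mono_neutral_right) (use that zero in auto)
    thus ?thesis by (simp add: index_mult_mat_sum[OF A(1) B(1) that that] del: index_mult_mat)
  qed
qed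

lemma upper_triangular_pow:
  fixes A :: "'a :: comm_semiring_1 mat"
  assumes A: "A \<in> carrier_mat n n" "upper_triangular A"
  shows "upper_triangular (A ^\<^sub>m k) \<and> (\<forall>i<n. (A ^\<^sub>m k) $$ (i, i) = A $$ (i, i) ^ k)"
proof (induction k)
  case 0
  show ?case using A by auto
next
  case (Suc k)
  thus ?case
    using A upper_triangular_mult[OF pow_carrier_mat[OF A(1)] _ A, of k] by (simp add: mult.commute)
qed

lemma eigenvalue_pow_eq:
  fixes A :: "'a :: field mat"
  assumes A: "A \<in> carrier_mat n n" and "eigenvalue A a" and pow: "A ^\<^sub>m k = A ^\<^sub>m l"
  shows "a ^ k = a ^ l"
proof -
  from assms(2) obtain v where ev: "eigenvector A v a" unfolding eigenvalue_def by blast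
  hence v: "v \<in> carrier_vec n" "v \<noteq> 0\<^sub>v n" using A by (auto simp: eigenvector_def)
  then obtain i where i: "i < n" "v $ i \<noteq> 0" by (auto simp: vec_eq_iff)
  have "a ^ k \<cdot>\<^sub>v v = a ^ l \<cdot>\<^sub>v v"
    unfolding eigenvector_pow[OF A ev, symmetric] pow ..
  hence "(a ^ k \<cdot>\<^sub>v v) $ i = (a ^ l \<cdot>\<^sub>v v) $ i" by simp
  thus ?thesis using i v by simp
qed

lemma eigenvalue_if_root:
  fixes A :: "'a :: field mat"
  assumes "A \<in> carrier_mat n n" "char_poly A = (\<Prod>a\<leftarrow>as. [:- a, 1:])" "a \<in> set as"
  shows "eigenvalue A a"
  using assms by (auto simp: eigenvalue_root_char_poly poly_prod_list prod_list_zero_iff)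

subsection \<open>Traces\<close>

lemma mat_trace_eq_sum: "A \<in> carrier_mat n n \<Longrightarrow> mat_trace A = (\<Sum>i<n. A $$ (i, i))"
  by (simp add: mat_trace_def)

lemma mat_trace_one [simp]: "mat_trace (1\<^sub>m n) = of_nat n"
  by (simp add: mat_trace_def)

lemma mat_trace_smult: "A \<in> carrier_mat n n \<Longrightarrow> mat_trace (c \<cdot>\<^sub>m A) = c * mat_trace A"
  by (simp add: mat_trace_def sum_distrib_left)

lemma mat_trace_mult_commute:
  assumes "A \<in> carrier_mat m n" "B \<in> carrier_mat n m"
  shows "mat_trace (A * B) = mat_trace (B * A)"
proof -
  have "mat_trace (A * B) = (\<Sum>i<m. \<Sum>k<n. A $$ (i, k) * B $$ (k, i))"
    using assms by (simp add: mat_trace_eq_sum[of _ m] index_mult_mat_sum[of _ m n] del: index_mult_mat)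
  also have "\<dots> = (\<Sum>k<n. \<Sum>i<m. B $$ (k, i) * A $$ (i, k))"
    by (subst sum.swap) (simp add: mult.commute)
  also have "\<dots> = mat_trace (B * A)"
    using assms by (simp add: mat_trace_eq_sum[of _ n] index_mult_mat_sum[of _ n m] del: index_mult_mat)
  finally show ?thesis .
qed

lemma mat_trace_similar:
  assumes "A \<in> carrier_mat n n" "similar_mat_wit A B P Q"
  shows "mat_trace A = mat_trace B"
proof -
  note wit = similar_mat_witD2[OF assms]
  have "mat_trace A = mat_trace (Q * (P * B))"
    unfolding wit(3) by (rule mat_trace_mult_commute[of _ n n]) (use wit in auto)
  also have "Q * (P * B) = Q * P * B"
    by (rule assoc_mult_mat[symmetric, of _ n n _ n _ n]) (use wit in auto)
  finally show ?thesis using wit by simp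
qed

lemma mat_trace_four_block_mat:
  assumes A: "A \<in> carrier_mat m m" and D: "D \<in> carrier_mat n n"
  shows "mat_trace (four_block_mat A B C D) = mat_trace A + mat_trace D"
proof -
  let ?M = "four_block_mat A B C D"
  have "mat_trace ?M = (\<Sum>i<m + n. ?M $$ (i, i))"
    using A D by (intro mat_trace_eq_sum) auto
  also have "\<dots> = (\<Sum>i<m. ?M $$ (i, i)) + (\<Sum>i<n. ?M $$ (m + i, m + i))"
    by (induction n) (auto simp: add.assoc)
  finally show ?thesis using A D by (simp add: mat_trace_def)
qed

lemma mat_trace_pow_eq_sum_roots:
  assumes A: "A \<in> carrier_mat n n" and as: "char_poly A = (\<Prod>a\<leftarrow>as. [:- a, 1:])"
  shows "mat_trace (A ^\<^sub>m k) = (\<Sum>a\<leftarrow>as. a ^ k)"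
proof -
  obtain B P Q where schur: "schur_decomposition A as = (B, P, Q)" by (cases "schur_decomposition A as")
  from schur_decomposition[OF A as schur]
  have decomp: "similar_mat_wit A B P Q" "upper_triangular B" "diag_mat B = as" by auto
  have B: "B \<in> carrier_mat n n" using similar_mat_witD2[OF A decomp(1)] by simp
  note Bk = pow_carrier_mat[OF B, of k]
  have "mat_trace (A ^\<^sub>m k) = mat_trace (B ^\<^sub>m k)"
    using mat_trace_similar[OF pow_carrier_mat[OF A] similar_mat_wit_pow[OF decomp(1)]] .
  also have "\<dots> = (\<Sum>i<n. B $$ (i, i) ^ k)"
    using upper_triangular_pow[OF B decomp(2)] by (simp add: mat_trace_eq_sum[OF Bk])
  also have "\<dots> = (\<Sum>a\<leftarrow>diag_mat B. a ^ k)"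
    using B by (simp add: diag_mat_def comp_def interv_sum_list_conv_sum_set_nat atLeast0LessThan)
  finally show ?thesis by (simp add: decomp(3))
qed

lemma mat_trace_idempotent_Ints:
  assumes A: "A \<in> carrier_mat n n" and idem: "A * A = A"
  shows "mat_trace A \<in> \<int>"
proof -
  from char_poly_factorized[OF A] obtain as where as: "char_poly A = (\<Prod>a\<leftarrow>as. [:- a, 1:])" by blast
  have "A ^\<^sub>m 2 = A ^\<^sub>m 1" using A idem by (simp add: numeral_2_eq_2)
  hence "a ^ 2 = a ^ 1" if "a \<in> set as" for a
    using eigenvalue_pow_eq[OF A eigenvalue_if_root[OF A as that]] by blast
  hence "a = 0 \<or> a = 1" if "a \<in> set as" for a using that by (simp add: power2_eq_square)
  hence "set as \<subseteq> \<int>" by (metis Ints_0 Ints_1 subsetI)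
  hence "(\<Sum>a\<leftarrow>as. a) \<in> \<int>" by (induction as) auto
  thus ?thesis using mat_trace_pow_eq_sum_roots[OF A as, of 1] A by simp
qed

subsection \<open>Kronecker products\<close>

definition kronecker_mat :: "'a :: times mat \<Rightarrow> 'a mat \<Rightarrow> 'a mat" where
  "kronecker_mat A B = mat (dim_row A * dim_row B) (dim_col A * dim_col B)
     (\<lambda>(i, j). A $$ (i div dim_row B, j div dim_col B) * B $$ (i mod dim_row B, j mod dim_col B))"

lemma kronecker_mat_carrier [simp]:
  "A \<in> carrier_mat m n \<Longrightarrow> B \<in> carrier_mat k l \<Longrightarrow> kronecker_mat A B \<in> carrier_mat (m * k) (n * l)"
  by (simp add: kronecker_mat_def)

lemma index_kronecker_mat:
  assumes "A \<in> carrier_mat m n" "B \<in> carrier_mat k l" "i < m * k" "j < n * l"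
  shows "kronecker_mat A B $$ (i, j) = A $$ (i div k, j div l) * B $$ (i mod k, j mod l)"
  using assms by (simp add: kronecker_mat_def)

lemma sum_lessThan_mult:
  fixes f :: "nat \<Rightarrow> 'a :: comm_monoid_add"
  shows "(\<Sum>i<m * n. f i) = (\<Sum>a<m. \<Sum>b<n. f (a * n + b))"
proof -
  have "(\<Sum>i = a * n..<a * n + n. f i) = (\<Sum>b<n. f (a * n + b))" for a
    using sum.shift_bounds_nat_ivl[of f 0 "a * n" n] by (simp add: atLeast0LessThan add.commute)
  thus ?thesis by (simp flip: sum.nat_group)
qed

lemma mult_add_less_mult:
  fixes a b m n :: nat
  assumes "a < m" "b < n"
  shows "a * n + b < m * n"
  using assms by (simp flip: div_less_iff_less_mult)

lemma div_less_mod_less: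
  fixes i m n :: nat
  assumes "i < m * n"
  shows "i div n < m" and "i mod n < n"
  using assms by (cases n; simp add: less_mult_imp_div_less)+

lemma kronecker_mat_mult:
  fixes A B C D :: "'a :: comm_semiring_0 mat"
  assumes A: "A \<in> carrier_mat m m" and B: "B \<in> carrier_mat n n"
    and C: "C \<in> carrier_mat m m" and D: "D \<in> carrier_mat n n"
  shows "kronecker_mat (A * C) (B * D) = kronecker_mat A B * kronecker_mat C D"
proof (rule eq_matI)
  fix i j assume "i < dim_row (kronecker_mat A B * kronecker_mat C D)"
    and "j < dim_col (kronecker_mat A B * kronecker_mat C D)"
  hence ij: "i < m * n" "j < m * n"
    using assms by (auto simp: kronecker_mat_def)
  note quot = div_less_mod_less[OF ij(1)] div_less_mod_less[OF ij(2)]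
  have "kronecker_mat (A * C) (B * D) $$ (i, j) = (A * C) $$ (i div n, j div n) * (B * D) $$ (i mod n, j mod n)"
    using assms ij by (intro index_kronecker_mat) auto
  also have "\<dots> = (\<Sum>a<m. A $$ (i div n, a) * C $$ (a, j div n)) * (\<Sum>b<n. B $$ (i mod n, b) * D $$ (b, j mod n))"
    by (simp only: index_mult_mat_sum[OF A C quot(1,3)] index_mult_mat_sum[OF B D quot(2,4)])
  also have "\<dots> = (\<Sum>a<m. \<Sum>b<n. kronecker_mat A B $$ (i, a * n + b) * kronecker_mat C D $$ (a * n + b, j))"
    unfolding sum_product
    by (intro sum.cong refl)
      (use ij mult_add_less_mult in \<open>simp add: index_kronecker_mat[OF A B] index_kronecker_mat[OF C D] mult_ac\<close>)
  also have "\<dots> = (kronecker_mat A B * kronecker_mat C D) $$ (i, j)"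
    using index_mult_mat_sum[OF kronecker_mat_carrier[OF A B] kronecker_mat_carrier[OF C D] ij]
    by (simp only: sum_lessThan_mult)
  finally show "kronecker_mat (A * C) (B * D) $$ (i, j) = (kronecker_mat A B * kronecker_mat C D) $$ (i, j)" .
qed (use assms in \<open>auto simp: kronecker_mat_def\<close>)

lemma kronecker_mat_one:
  "kronecker_mat (1\<^sub>m m) (1\<^sub>m n) = (1\<^sub>m (m * n) :: 'a :: semiring_1 mat)"
proof (rule eq_matI)
  fix i j assume "i < dim_row (1\<^sub>m (m * n) :: 'a mat)" "j < dim_col (1\<^sub>m (m * n) :: 'a mat)"
  hence ij: "i < m * n" "j < m * n" by auto
  note quot = div_less_mod_less[OF ij(1)] div_less_mod_less[OF ij(2)]
  have "i div n = j div n \<and> i mod n = j mod n \<longleftrightarrow> i = j"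
    by (metis div_mult_mod_eq)
  thus "kronecker_mat (1\<^sub>m m) (1\<^sub>m n) $$ (i, j) = (1\<^sub>m (m * n) :: 'a mat) $$ (i, j)"
    using ij quot by (auto simp: index_kronecker_mat[of _ m m _ n n])
qed (auto simp: kronecker_mat_def)

lemma mat_trace_kronecker_mat:
  assumes A: "A \<in> carrier_mat m m" and B: "B \<in> carrier_mat n n"
  shows "mat_trace (kronecker_mat A B) = mat_trace A * mat_trace B"
proof -
  have "mat_trace (kronecker_mat A B) = (\<Sum>a<m. \<Sum>b<n. A $$ (a, a) * B $$ (b, b))"
    unfolding mat_trace_eq_sum[OF kronecker_mat_carrier[OF A B]] sum_lessThan_mult
    by (intro sum.cong refl) (use mult_add_less_mult in \<open>simp add: index_kronecker_mat[OF A B]\<close>)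
  thus ?thesis using assms by (simp add: mat_trace_def sum_product)
qed

subsection \<open>Sums of families of matrices\<close>

definition mat_sum :: "nat \<Rightarrow> nat \<Rightarrow> ('i \<Rightarrow> 'a :: comm_monoid_add mat) \<Rightarrow> 'i set \<Rightarrow> 'a mat" where
  "mat_sum m n F I = mat m n (\<lambda>(i, j). \<Sum>x\<in>I. F x $$ (i, j))"

lemma mat_sum_carrier [simp]: "mat_sum m n F I \<in> carrier_mat m n"
  by (simp add: mat_sum_def)

lemma index_mat_sum: "i < m \<Longrightarrow> j < n \<Longrightarrow> mat_sum m n F I $$ (i, j) = (\<Sum>x\<in>I. F x $$ (i, j))"
  by (simp add: mat_sum_def)

lemma mat_sum_cong: "(\<And>x. x \<in> I \<Longrightarrow> F x = F' x) \<Longrightarrow> mat_sum m n F I = mat_sum m n F' I"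
  by (simp add: mat_sum_def cong: sum.cong)

lemma mat_sum_reindex_bij_betw:
  assumes "bij_betw h I J"
  shows "mat_sum m n (\<lambda>x. F (h x)) I = mat_sum m n F J"
  unfolding mat_sum_def using sum.reindex_bij_betw[OF assms] by (intro eq_matI) auto

lemma mat_sum_const:
  fixes A :: "'a :: semiring_1 mat"
  assumes "A \<in> carrier_mat m n"
  shows "mat_sum m n (\<lambda>_. A) I = of_nat (card I) \<cdot>\<^sub>m A"
  using assms by (intro eq_matI) (auto simp: mat_sum_def)

lemma mult_mat_sum:
  fixes A :: "'a :: semiring_0 mat"
  assumes A: "A \<in> carrier_mat l m" and F: "\<And>x. x \<in> I \<Longrightarrow> F x \<in> carrier_mat m n"
  shows "A * mat_sum m n F I = mat_sum l n (\<lambda>x. A * F x) I"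
proof (rule eq_matI)
  fix i j assume "i < dim_row (mat_sum l n (\<lambda>x. A * F x) I)" "j < dim_col (mat_sum l n (\<lambda>x. A * F x) I)"
  hence ij: "i < l" "j < n" by (auto simp: mat_sum_def)
  have "(A * mat_sum m n F I) $$ (i, j) = (\<Sum>k<m. \<Sum>x\<in>I. A $$ (i, k) * F x $$ (k, j))"
    unfolding index_mult_mat_sum[OF A mat_sum_carrier ij] using ij by (simp add: index_mat_sum sum_distrib_left)
  also have "\<dots> = (\<Sum>x\<in>I. (A * F x) $$ (i, j))"
    by (subst sum.swap) (use ij in \<open>simp add: index_mult_mat_sum[OF A F] del: index_mult_mat\<close>)
  finally show "(A * mat_sum m n F I) $$ (i, j) = mat_sum l n (\<lambda>x. A * F x) I $$ (i, j)"
    using ij by (simp only: index_mat_sum)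
qed (use A in \<open>auto simp: mat_sum_def\<close>)

lemma mat_sum_mult:
  fixes A :: "'a :: semiring_0 mat"
  assumes A: "A \<in> carrier_mat m n" and F: "\<And>x. x \<in> I \<Longrightarrow> F x \<in> carrier_mat l m"
  shows "mat_sum l m F I * A = mat_sum l n (\<lambda>x. F x * A) I"
proof (rule eq_matI)
  fix i j assume "i < dim_row (mat_sum l n (\<lambda>x. F x * A) I)" "j < dim_col (mat_sum l n (\<lambda>x. F x * A) I)"
  hence ij: "i < l" "j < n" by (auto simp: mat_sum_def)
  have "(mat_sum l m F I * A) $$ (i, j) = (\<Sum>k<m. \<Sum>x\<in>I. F x $$ (i, k) * A $$ (k, j))"
    unfolding index_mult_mat_sum[OF mat_sum_carrier A ij] using ij by (simp add: index_mat_sum sum_distrib_right)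
  also have "\<dots> = (\<Sum>x\<in>I. (F x * A) $$ (i, j))"
    by (subst sum.swap) (use ij in \<open>simp add: index_mult_mat_sum[OF F A] del: index_mult_mat\<close>)
  finally show "(mat_sum l m F I * A) $$ (i, j) = mat_sum l n (\<lambda>x. F x * A) I $$ (i, j)"
    using ij by (simp only: index_mat_sum)
qed (use A in \<open>auto simp: mat_sum_def\<close>)

lemma mat_trace_mat_sum:
  assumes "\<And>x. x \<in> I \<Longrightarrow> F x \<in> carrier_mat n n"
  shows "mat_trace (mat_sum n n F I) = (\<Sum>x\<in>I. mat_trace (F x))"
proof -
  have "mat_trace (mat_sum n n F I) = (\<Sum>i<n. \<Sum>x\<in>I. F x $$ (i, i))"
    by (simp add: mat_trace_eq_sum[OF mat_sum_carrier] index_mat_sum)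
  also have "\<dots> = (\<Sum>x\<in>I. mat_trace (F x))"
    by (subst sum.swap) (simp add: mat_trace_eq_sum[OF assms])
  finally show ?thesis .
qed

definition matrix_unit :: "nat \<Rightarrow> nat \<Rightarrow> nat \<Rightarrow> nat \<Rightarrow> 'a :: zero_neq_one mat" where
  "matrix_unit m n i j = mat m n (\<lambda>ij. if ij = (i, j) then 1 else 0)"

lemma matrix_unit_carrier [simp]: "matrix_unit m n i j \<in> carrier_mat m n"
  by (simp add: matrix_unit_def)

lemma mat_trace_matrix_unit:
  assumes "i < n"
  shows "mat_trace (matrix_unit n n i j) = (if i = j then 1 else 0)"
proof -
  have "mat_trace (matrix_unit n n i j) = (\<Sum>k<n. if k = i then (if i = j then 1 else 0) else 0)"
    unfolding mat_trace_eq_sum[OF matrix_unit_carrier]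
    by (intro sum.cong refl) (auto simp: matrix_unit_def)
  thus ?thesis using assms by simp
qed

lemma index_mult_matrix_unit_mult:
  fixes A B :: "'a :: semiring_1 mat"
  assumes A: "A \<in> carrier_mat m m" and B: "B \<in> carrier_mat n n" and ij: "i < m" "j < n"
  shows "(A * matrix_unit m n i j * B) $$ (i, j) = A $$ (i, i) * B $$ (j, j)"
proof -
  have "(A * matrix_unit m n i j) $$ (i, l) = (if l = j then A $$ (i, i) else 0)" if "l < n" for l
  proof -
    have "A $$ (i, k) * matrix_unit m n i j $$ (k, l) = (if k = i then (if l = j then A $$ (i, i) else 0) else 0)"
      if "k < m" for k using that \<open>l < n\<close> by (auto simp: matrix_unit_def)
    thus ?thesis
      using ij that by (simp add: index_mult_mat_sum[OF A matrix_unit_carrier] del: index_mult_mat)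
  qed
  moreover have "(if l = j then A $$ (i, i) else 0) * B $$ (l, j)
      = (if l = j then A $$ (i, i) * B $$ (j, j) else 0)" for l
    by simp
  ultimately show ?thesis
    using ij by (simp add: index_mult_mat_sum[OF mult_carrier_mat[OF A matrix_unit_carrier] B] del: index_mult_mat)
qed

lemma mat_trace_mult_mat_trace:
  assumes "A \<in> carrier_mat m m" "B \<in> carrier_mat n n"
  shows "mat_trace A * mat_trace B = (\<Sum>i<m. \<Sum>j<n. (A * matrix_unit m n i j * B) $$ (i, j))"
  by (simp add: mat_trace_eq_sum[OF assms(1)] mat_trace_eq_sum[OF assms(2)] sum_product
      index_mult_matrix_unit_mult[OF assms] del: index_mult_mat)

section \<open>Cyclotomic integers\<close>

text \<open>Membership is stated in terms of the powers of one primitive root because these finitely many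
  generators are what makes multiplication by a fixed element an integer matrix.\<close>

definition cyclotomic_ints :: "nat \<Rightarrow> complex set" where
  "cyclotomic_ints N = {z. \<exists>a :: nat \<Rightarrow> int. z = (\<Sum>k<N. of_int (a k) * cis (2 * pi / N) ^ k)}"

lemma cyclotomic_ints_int_combination:
  assumes "\<And>x. x \<in> A \<Longrightarrow> f x \<in> cyclotomic_ints N"
  shows "(\<Sum>x\<in>A. of_int (c x) * f x) \<in> cyclotomic_ints N"
proof -
  have "\<forall>x\<in>A. \<exists>a :: nat \<Rightarrow> int. f x = (\<Sum>k<N. of_int (a k) * cis (2 * pi / N) ^ k)"
    using assms unfolding cyclotomic_ints_def by blast
  then obtain a :: "_ \<Rightarrow> nat \<Rightarrow> int"
    where a: "\<And>x. x \<in> A \<Longrightarrow> f x = (\<Sum>k<N. of_int (a x k) * cis (2 * pi / N) ^ k)" by metis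
  have "(\<Sum>x\<in>A. of_int (c x) * f x) = (\<Sum>x\<in>A. \<Sum>k<N. of_int (c x * a x k) * cis (2 * pi / N) ^ k)"
    by (intro sum.cong refl) (simp add: a sum_distrib_left mult.assoc)
  also have "\<dots> = (\<Sum>k<N. of_int (\<Sum>x\<in>A. c x * a x k) * cis (2 * pi / N) ^ k)"
    by (subst sum.swap) (simp add: sum_distrib_right)
  finally show ?thesis unfolding cyclotomic_ints_def by (intro CollectI exI)
qed

lemma cyclotomic_ints_sum:
  assumes "\<And>x. x \<in> A \<Longrightarrow> f x \<in> cyclotomic_ints N"
  shows "sum f A \<in> cyclotomic_ints N"
  using cyclotomic_ints_int_combination[where c = "\<lambda>_. 1", OF assms] by simp

lemma root_of_unity_in_cyclotomic_ints:
  assumes "N > 0" "z ^ N = 1"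
  shows "z \<in> cyclotomic_ints N"
proof -
  have "z \<in> (\<lambda>k. cis (2 * pi * real k / real N)) ` {..<N}"
    using bij_betw_roots_unity[OF assms(1)] assms(2) unfolding bij_betw_def by auto
  then obtain k where k: "k < N" "z = cis (2 * pi / N) ^ k"
    by (auto simp: DeMoivre mult_ac)
  hence "z = (\<Sum>j<N. of_int (if j = k then 1 else 0) * cis (2 * pi / N) ^ j)"
    by (simp add: if_distrib if_distribR cong: if_cong)
  thus ?thesis unfolding cyclotomic_ints_def by (intro CollectI exI)
qed

lemma of_int_in_cyclotomic_ints: "N > 0 \<Longrightarrow> of_int m \<in> cyclotomic_ints N"
  using cyclotomic_ints_int_combination[of "{()}" "\<lambda>_. 1" N "\<lambda>_. m"] root_of_unity_in_cyclotomic_ints[of N 1]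
  by simp

lemma cyclotomic_ints_mult:
  assumes N: "N > 0" and "x \<in> cyclotomic_ints N" "y \<in> cyclotomic_ints N"
  shows "x * y \<in> cyclotomic_ints N"
proof -
  let ?w = "cis (2 * pi / N)"
  from assms obtain a b :: "nat \<Rightarrow> int"
    where "x = (\<Sum>k<N. of_int (a k) * ?w ^ k)" "y = (\<Sum>l<N. of_int (b l) * ?w ^ l)"
    unfolding cyclotomic_ints_def by blast
  hence "x * y = (\<Sum>(k, l)\<in>{..<N} \<times> {..<N}. of_int (a k * b l) * ?w ^ (k + l))"
    by (simp add: sum_product sum.cartesian_product power_add mult_ac)
  moreover have "?w ^ m \<in> cyclotomic_ints N" for m
  proof (rule root_of_unity_in_cyclotomic_ints[OF N])
    have "(?w ^ m) ^ N = (?w ^ N) ^ m" by (simp add: mult.commute flip: power_mult)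
    thus "(?w ^ m) ^ N = 1" using N by (simp add: DeMoivre)
  qed
  ultimately show ?thesis
    using cyclotomic_ints_int_combination[of "{..<N} \<times> {..<N}" "\<lambda>(k, l). ?w ^ (k + l)" N "\<lambda>(k, l). a k * b l"]
    by (simp add: case_prod_unfold)
qed

lemma power_pred_root_of_unity:
  fixes a :: complex
  assumes "n > 0" "a ^ n = 1"
  shows "a ^ (n - 1) = cnj a"
proof -
  have "norm a = 1" using power_eq_1_iff[OF assms(2)] assms(1) by simp
  hence "a * cnj a = 1" by (simp flip: complex_norm_square)
  moreover have "a * a ^ (n - 1) = 1" using assms by (simp add: power_eq_if)
  ultimately show ?thesis by (metis mult_cancel_left mult_zero_left zero_neq_one)
qed

lemma algebraic_int_if_int_mat_eigenvalue:
  fixes z :: "'a :: field_char_0"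
  assumes A: "A \<in> carrier_mat n n" and z: "eigenvalue (map_mat of_int A) z"
  shows "algebraic_int z"
proof -
  have "poly (map_poly of_int (char_poly A)) z = 0"
    using z A by (simp add: eigenvalue_root_char_poly[of _ n] of_int_hom.char_poly_hom)
  moreover have "lead_coeff (char_poly A) = 1" using degree_monic_char_poly[OF A] by simp
  ultimately show ?thesis unfolding algebraic_int_altdef_ipoly by blast
qed

lemma cyclotomic_ints_algebraic_int:
  assumes N: "N > 0" and z: "z \<in> cyclotomic_ints N"
  shows "algebraic_int z"
proof -
  let ?w = "cis (2 * pi / N)"
  have "?w ^ N = 1" using N by (simp add: DeMoivre)
  hence "(?w ^ i) ^ N = 1" for i by (metis mult.commute power_mult power_one)
  hence "z * ?w ^ i \<in> cyclotomic_ints N" for i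
    by (intro cyclotomic_ints_mult[OF N z] root_of_unity_in_cyclotomic_ints[OF N])
  hence "\<forall>i. \<exists>a :: nat \<Rightarrow> int. z * ?w ^ i = (\<Sum>k<N. of_int (a k) * ?w ^ k)"
    unfolding cyclotomic_ints_def by blast
  then obtain M :: "nat \<Rightarrow> nat \<Rightarrow> int" where M: "\<And>i. z * ?w ^ i = (\<Sum>k<N. of_int (M i k) * ?w ^ k)"
    by metis
  define A where "A = mat N N (\<lambda>(i, k). M i k)"
  define v where "v = vec N (\<lambda>k. ?w ^ k)"
  have "v \<noteq> 0\<^sub>v N" using N by (auto simp: v_def vec_eq_iff)
  moreover have "map_mat of_int A *\<^sub>v v = z \<cdot>\<^sub>v v"
    by (rule eq_vecI) (auto simp: A_def v_def scalar_prod_def M atLeast0LessThan)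
  ultimately have "eigenvector (map_mat of_int A) v z"
    by (simp add: eigenvector_def A_def v_def)
  thus ?thesis
    using algebraic_int_if_int_mat_eigenvalue[of A N z] by (auto simp: eigenvalue_def A_def)
qed

lemma not_div_by_iff_cyclotomic_ints:
  assumes p: "p > 0" and N: "N > 0" and z: "z \<in> \<int>"
  shows "not_div_by p z \<longleftrightarrow> z / of_nat p \<notin> cyclotomic_ints N"
proof -
  have "z = of_int (int p * m) \<longleftrightarrow> z / of_nat p = of_int m" for m
    using p by (auto simp: field_simps)
  moreover have "z / of_nat p \<in> \<int>" if "z / of_nat p \<in> cyclotomic_ints N"
  proof (rule rational_algebraic_int_is_int)
    show "algebraic_int (z / of_nat p)" using cyclotomic_ints_algebraic_int[OF N that] .
    show "z / of_nat p \<in> \<rat>" using z Ints_subset_Rats by (intro Rats_divide) auto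
  qed
  ultimately show ?thesis
    unfolding not_div_by_def using of_int_in_cyclotomic_ints[OF N] by (metis Ints_cases)
qed

section \<open>Conjugacy classes and class functions\<close>

context group
begin

lemma bij_betw_l_mult: "a \<in> carrier G \<Longrightarrow> bij_betw ((\<otimes>) a) (carrier G) (carrier G)"
  by (simp add: bij_betw_def inj_on_cmult surj_const_mult)

lemma bij_betw_conjugate: "a \<in> carrier G \<Longrightarrow> bij_betw (\<lambda>g. a \<otimes> g \<otimes> inv a) (carrier G) (carrier G)"
  using conjugation_is_bij by simp

lemma mem_conj_class_iff: "h \<in> conj_class G g \<longleftrightarrow> (\<exists>x\<in>carrier G. h = x \<otimes> g \<otimes> inv x)"
  unfolding conj_class_def by blast

abbreviation conjugation :: "'a \<Rightarrow> 'a \<Rightarrow> 'a" where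
  "conjugation \<equiv> \<lambda>x. \<lambda>g\<in>carrier G. x \<otimes> g \<otimes> inv x"

interpretation conj: group_action G "carrier G" conjugation
  by (rule action_by_conjugation)

lemma conj_class_eq_orbit:
  assumes "g \<in> carrier G"
  shows "conj_class G g = orbit G conjugation g"
  using assms by (simp add: conj_class_def orbit_def)

lemma conj_class_subset: "g \<in> carrier G \<Longrightarrow> conj_class G g \<subseteq> carrier G"
  unfolding conj_class_def by auto

lemma conj_class_refl: "g \<in> carrier G \<Longrightarrow> g \<in> conj_class G g"
  using conj.orbit_refl by (simp add: conj_class_eq_orbit)

lemma conj_class_eq:
  assumes "g \<in> carrier G" "h \<in> conj_class G g"
  shows "conj_class G h = conj_class G g"
proof -
  have h: "h \<in> carrier G" using assms conj_class_subset by blast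
  have "g \<in> conj_class G h"
    using conj.orbit_sym assms h by (simp add: conj_class_eq_orbit)
  moreover have "conj_class G b \<subseteq> conj_class G a"
    if "a \<in> carrier G" "b \<in> carrier G" "b \<in> conj_class G a" for a b
    using conj.orbit_trans[OF that(1,2)] conj_class_subset[OF that(2)] that
    by (auto simp: conj_class_eq_orbit)
  ultimately show ?thesis using assms h by blast
qed

lemma inv_image_conj_class:
  assumes g: "g \<in> carrier G"
  shows "(\<lambda>x. inv x) ` conj_class G g = conj_class G (inv g)"
proof -
  have "inv (x \<otimes> g \<otimes> inv x) = x \<otimes> inv g \<otimes> inv x" if "x \<in> carrier G" for x
    using g that by (simp add: inv_mult_group m_assoc)
  thus ?thesis unfolding conj_class_def by force
qed

lemma real_class_iff:
  assumes g: "g \<in> carrier G"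
  shows "real_class G (conj_class G g) \<longleftrightarrow> inv g \<in> conj_class G g"
  unfolding real_class_def inv_image_conj_class[OF g]
  using conj_class_eq[OF g] conj_class_refl[of "inv g"] g by auto

definition centralizer :: "'a \<Rightarrow> 'a set" where
  "centralizer g = {x \<in> carrier G. x \<otimes> g \<otimes> inv x = g}"

lemma card_conj_class_times_centralizer:
  assumes "g \<in> carrier G"
  shows "card (conj_class G g) * card (centralizer g) = order G"
proof -
  have "centralizer g = stabilizer G conjugation g"
    using assms by (simp add: centralizer_def stabilizer_def)
  thus ?thesis
    using conj.orbit_stabilizer_theorem[OF assms] by (simp add: conj_class_eq_orbit[OF assms])
qed

lemma sum_conj_classes:
  assumes "finite (carrier G)"
  shows "(\<Sum>K\<in>conj_class G ` carrier G. sum f K) = sum f (carrier G)"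
proof -
  have "conj_class G ` carrier G = orbits G (carrier G) conjugation"
    unfolding orbits_def using conj_class_eq_orbit by blast
  thus ?thesis using conj.disjoint_sum[OF assms] by simp
qed

definition class_function :: "('a \<Rightarrow> 'c) \<Rightarrow> bool" where
  "class_function f \<longleftrightarrow> (\<forall>x\<in>carrier G. \<forall>g\<in>carrier G. f (x \<otimes> g \<otimes> inv x) = f g)"

lemma class_function_conjugate:
  "class_function f \<Longrightarrow> x \<in> carrier G \<Longrightarrow> g \<in> carrier G \<Longrightarrow> f (x \<otimes> g \<otimes> inv x) = f g"
  by (simp add: class_function_def)

lemma class_function_eq:
  assumes "class_function f" "g \<in> carrier G" "h \<in> conj_class G g"
  shows "f h = f g"
  using assms by (auto simp: mem_conj_class_iff class_function_conjugate)

lemma class_functionI: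
  assumes "\<And>g h. g \<in> carrier G \<Longrightarrow> h \<in> carrier G \<Longrightarrow> h \<in> conj_class G g \<Longrightarrow> f h = f g"
  shows "class_function f"
  unfolding class_function_def by (intro ballI assms) (auto simp: mem_conj_class_iff)

lemma class_function_combine:
  assumes "class_function f" "class_function h"
  shows "class_function (\<lambda>g. F (f g) (h g))"
  using assms by (simp add: class_function_def)

lemma class_function_conj_class: "class_function (conj_class G)"
  by (intro class_functionI conj_class_eq)

end

locale finite_group = group G for G (structure) +
  assumes finite_carrier: "finite (carrier G)"
begin

lemma order_pos: "order G > 0"
  by (simp add: order_gt_0_iff_finite finite_carrier)

lemma card_conj_class_pos: "g \<in> carrier G \<Longrightarrow> card (conj_class G g) > 0"
  and card_centralizer_pos: "g \<in> carrier G \<Longrightarrow> card (centralizer g) > 0"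
  using card_conj_class_times_centralizer order_pos by (metis gr0I mult_is_0)+

lemma class_function_card_centralizer: "class_function (\<lambda>g. card (centralizer g))"
proof (rule class_functionI)
  fix g h assume gh: "g \<in> carrier G" "h \<in> carrier G" "h \<in> conj_class G g"
  hence "card (conj_class G g) * card (centralizer h) = card (conj_class G g) * card (centralizer g)"
    using card_conj_class_times_centralizer conj_class_eq by metis
  thus "card (centralizer h) = card (centralizer g)" using card_conj_class_pos[OF gh(1)] by simp
qed

lemma p_defect_zero_iff:
  assumes p: "prime p" and g: "g \<in> carrier G"
  shows "p_defect_zero G p (conj_class G g) \<longleftrightarrow> \<not> p dvd card (centralizer g)"
proof -
  have "multiplicity p (order G) = multiplicity p (card (conj_class G g)) + multiplicity p (card (centralizer g))"
    using p card_conj_class_pos[OF g] card_centralizer_pos[OF g]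
    by (simp add: prime_elem_multiplicity_mult_distrib flip: card_conj_class_times_centralizer[OF g])
  moreover have "p > 1" using p by (rule prime_gt_1_nat)
  ultimately have "p_defect_zero G p (conj_class G g) \<longleftrightarrow> multiplicity p (card (centralizer g)) = 0"
    by (simp add: p_defect_zero_def p_part_def flip: order_def)
  thus ?thesis
    using p card_centralizer_pos[OF g] by (simp add: prime_elem_multiplicity_eq_zero_iff)
qed

text \<open>By the orbit-stabilizer theorem, the conjugacy class of \<open>g\<close> contributes \<open>f(g)\<close> to the average.\<close>

lemma average_centralizer_multiple_cyclotomic:
  assumes f: "class_function f" and cyclotomic: "\<And>g. g \<in> carrier G \<Longrightarrow> f g \<in> cyclotomic_ints N"
  shows "(\<Sum>g\<in>carrier G. of_nat (card (centralizer g)) * f g) / of_nat (order G) \<in> cyclotomic_ints N"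
proof -
  have class_sum: "(\<Sum>h\<in>conj_class G g. of_nat (card (centralizer h)) * f h) / of_nat (order G) = f g"
    if g: "g \<in> carrier G" for g
  proof -
    have "(\<Sum>h\<in>conj_class G g. of_nat (card (centralizer h)) * f h)
        = of_nat (card (conj_class G g) * card (centralizer g)) * f g"
      by (simp add: class_function_eq[OF f g] class_function_eq[OF class_function_card_centralizer g])
    thus ?thesis using order_pos by (simp only: card_conj_class_times_centralizer[OF g]) simp
  qed
  have "(\<Sum>K\<in>conj_class G ` carrier G. (\<Sum>h\<in>K. of_nat (card (centralizer h)) * f h) / of_nat (order G))
      \<in> cyclotomic_ints N"
    by (rule cyclotomic_ints_sum) (auto simp: class_sum cyclotomic)
  thus ?thesis by (simp add: sum_conj_classes[OF finite_carrier] flip: sum_divide_distrib)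
qed

end

section \<open>Characters\<close>

lemma (in monoid) rep_carrier: "is_rep G d \<rho> \<Longrightarrow> g \<in> carrier G \<Longrightarrow> \<rho> g \<in> carrier_mat d d"
  and rep_one: "is_rep G d \<rho> \<Longrightarrow> \<rho> \<one> = 1\<^sub>m d"
  and rep_mult: "is_rep G d \<rho> \<Longrightarrow> g \<in> carrier G \<Longrightarrow> h \<in> carrier G \<Longrightarrow> \<rho> (g \<otimes> h) = \<rho> g * \<rho> h"
  by (auto simp: is_rep_def)

lemma (in monoid) rep_pow:
  assumes "is_rep G d \<rho>" "g \<in> carrier G"
  shows "\<rho> (g [^] (k :: nat)) = \<rho> g ^\<^sub>m k"
  by (induction k) (use assms rep_carrier[OF assms] in \<open>auto simp: rep_one rep_mult\<close>)

lemma cf_inner_cong: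
  assumes "\<And>g. g \<in> carrier G \<Longrightarrow> \<alpha> g = \<alpha>' g" "\<And>g. g \<in> carrier G \<Longrightarrow> \<beta> g = \<beta>' g"
  shows "cf_inner G \<alpha> \<beta> = cf_inner G \<alpha>' \<beta>'"
  unfolding cf_inner_def using assms by simp

lemma cnj_cf_inner: "cnj (cf_inner G \<alpha> \<beta>) = cf_inner G \<beta> \<alpha>"
  by (simp add: cf_inner_def mult.commute)

lemma cf_inner_diff_left: "cf_inner G (\<lambda>g. \<alpha> g - \<beta> g) \<gamma> = cf_inner G \<alpha> \<gamma> - cf_inner G \<beta> \<gamma>"
  by (simp add: cf_inner_def left_diff_distrib sum_subtractf diff_divide_distrib)

lemma cf_inner_sum_left:
  "cf_inner G (\<lambda>g. \<Sum>x\<in>A. c x * \<alpha> x g) \<beta> = (\<Sum>x\<in>A. c x * cf_inner G (\<alpha> x) \<beta>)"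
proof -
  have "(\<Sum>g\<in>carrier G. (\<Sum>x\<in>A. c x * \<alpha> x g) * cnj (\<beta> g)) = (\<Sum>x\<in>A. c x * (\<Sum>g\<in>carrier G. \<alpha> x g * cnj (\<beta> g)))"
    unfolding sum_distrib_left sum_distrib_right by (subst sum.swap) (simp add: mult.assoc)
  thus ?thesis by (simp add: cf_inner_def flip: sum_divide_distrib)
qed

lemma cf_inner_sum_right: "cf_inner G \<alpha> (\<lambda>g. \<Sum>x\<in>A. \<beta> x g) = (\<Sum>x\<in>A. cf_inner G \<alpha> (\<beta> x))"
  unfolding cf_inner_def cnj_sum sum_distrib_left sum_divide_distrib[symmetric] by (subst sum.swap) simp

lemma Re_cf_inner_self_nonneg: "Re (cf_inner G \<alpha> \<alpha>) \<ge> 0"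
  unfolding cf_inner_def complex_norm_square[symmetric] by (simp add: Re_divide_of_nat sum_nonneg)

context finite_group
begin

lemma rep_pow_order:
  assumes "is_rep G d \<rho>" "g \<in> carrier G"
  shows "\<rho> g ^\<^sub>m order G = 1\<^sub>m d"
  using rep_pow[OF assms, of "order G"] pow_order_eq_1[OF assms(2)] rep_one[OF assms(1)] by simp

lemma rep_eigenvalue_root_of_unity:
  assumes rep: "is_rep G d \<rho>" and g: "g \<in> carrier G" and a: "eigenvalue (\<rho> g) a"
  shows "a ^ order G = 1"
proof -
  note carrier = rep_carrier[OF rep g]
  have "\<rho> g ^\<^sub>m order G = \<rho> g ^\<^sub>m 0" using rep_pow_order[OF rep g] carrier by simp
  thus ?thesis using eigenvalue_pow_eq[OF carrier a, of "order G" 0] by simp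
qed

lemma rep_trace_cyclotomic:
  assumes rep: "is_rep G d \<rho>" and g: "g \<in> carrier G"
  shows "mat_trace (\<rho> g) \<in> cyclotomic_ints (order G)"
proof -
  note carrier = rep_carrier[OF rep g]
  from char_poly_factorized[OF carrier] obtain as where as: "char_poly (\<rho> g) = (\<Prod>a\<leftarrow>as. [:- a, 1:])" by blast
  have "as ! i \<in> cyclotomic_ints (order G)" if "i < length as" for i
    using that rep_eigenvalue_root_of_unity[OF rep g eigenvalue_if_root[OF carrier as]]
    by (intro root_of_unity_in_cyclotomic_ints order_pos) auto
  hence "(\<Sum>i<length as. as ! i) \<in> cyclotomic_ints (order G)" by (intro cyclotomic_ints_sum) auto
  thus ?thesis
    using mat_trace_pow_eq_sum_roots[OF carrier as, of 1] carrier by (simp add: sum_list_sum_nth atLeast0LessThan)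
qed

lemma inv_eq_pow:
  assumes "g \<in> carrier G"
  shows "inv g = g [^] (order G - 1)"
proof (rule inv_equality)
  have "g [^] (order G - 1) \<otimes> g = g [^] order G"
    using order_pos by (simp flip: nat_pow_Suc)
  thus "g [^] (order G - 1) \<otimes> g = \<one>" using assms by (simp add: pow_order_eq_1)
qed (use assms in auto)

lemma rep_trace_inv:
  assumes rep: "is_rep G d \<rho>" and g: "g \<in> carrier G"
  shows "mat_trace (\<rho> (inv g)) = cnj (mat_trace (\<rho> g))"
proof -
  note carrier = rep_carrier[OF rep g]
  from char_poly_factorized[OF carrier] obtain as where as: "char_poly (\<rho> g) = (\<Prod>a\<leftarrow>as. [:- a, 1:])" by blast
  have "mat_trace (\<rho> (inv g)) = (\<Sum>a\<leftarrow>as. a ^ (order G - 1))"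
    using rep_pow[OF rep g] by (simp add: inv_eq_pow[OF g] mat_trace_pow_eq_sum_roots[OF carrier as])
  also have "\<dots> = (\<Sum>a\<leftarrow>as. cnj a)"
    using rep_eigenvalue_root_of_unity[OF rep g eigenvalue_if_root[OF carrier as]]
    by (intro arg_cong[where f = sum_list] map_cong refl power_pred_root_of_unity order_pos)
  also have "\<dots> = cnj (\<Sum>a\<leftarrow>as. a)" by (induction as) auto
  also have "(\<Sum>a\<leftarrow>as. a) = mat_trace (\<rho> g)"
    using mat_trace_pow_eq_sum_roots[OF carrier as, of 1] carrier by simp
  finally show ?thesis .
qed

text \<open>The average of a representation is idempotent: it projects onto the fixed vectors.\<close>

lemma average_rep_trace_Ints:
  assumes rep: "is_rep G d \<rho>"
  shows "(\<Sum>g\<in>carrier G. mat_trace (\<rho> g)) / of_nat (order G) \<in> \<int>"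
proof -
  note carrier = rep_carrier[OF rep]
  define S where "S = mat_sum d d \<rho> (carrier G)"
  have S: "S \<in> carrier_mat d d" by (simp add: S_def)
  have "\<rho> h * S = S" if h: "h \<in> carrier G" for h
  proof -
    have "\<rho> h * S = mat_sum d d (\<lambda>g. \<rho> h * \<rho> g) (carrier G)"
      unfolding S_def by (rule mult_mat_sum) (use carrier h in auto)
    also have "\<dots> = mat_sum d d (\<lambda>g. \<rho> (h \<otimes> g)) (carrier G)"
      by (rule mat_sum_cong) (simp add: rep_mult[OF rep h])
    also have "\<dots> = S"
      unfolding S_def by (rule mat_sum_reindex_bij_betw[OF bij_betw_l_mult[OF h]])
    finally show ?thesis .
  qed
  hence "mat_sum d d (\<lambda>g. \<rho> g * S) (carrier G) = mat_sum d d (\<lambda>_. S) (carrier G)"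
    by (rule mat_sum_cong)
  moreover have "S * S = mat_sum d d (\<lambda>g. \<rho> g * S) (carrier G)"
    by (subst (1) S_def) (rule mat_sum_mult[OF S carrier])
  ultimately have S_times_S: "S * S = of_nat (order G) \<cdot>\<^sub>m S"
    by (simp add: mat_sum_const[OF S] order_def)
  define E where "E = (1 / of_nat (order G)) \<cdot>\<^sub>m S"
  have E: "E \<in> carrier_mat d d" using S by (simp add: E_def)
  have "E * E = (1 / of_nat (order G)) \<cdot>\<^sub>m ((1 / of_nat (order G)) \<cdot>\<^sub>m (S * S))"
    using S by (simp add: E_def mult_smult_assoc_mat[of _ d d] mult_smult_distrib[of _ d d])
  also have "\<dots> = E" unfolding S_times_S E_def using order_pos by (intro eq_matI) auto
  finally have "E * E = E" .
  hence "mat_trace E \<in> \<int>" by (rule mat_trace_idempotent_Ints[OF E])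
  moreover have "mat_trace S = (\<Sum>g\<in>carrier G. mat_trace (\<rho> g))"
    unfolding S_def by (rule mat_trace_mat_sum[OF carrier])
  ultimately show ?thesis by (simp add: E_def mat_trace_smult[OF S])
qed

definition is_character :: "('a \<Rightarrow> complex) \<Rightarrow> bool" where
  "is_character \<alpha> \<longleftrightarrow> (\<exists>d \<rho>. is_rep G d \<rho> \<and> (\<forall>g\<in>carrier G. \<alpha> g = mat_trace (\<rho> g)))"

lemma is_characterI:
  assumes "is_rep G d \<rho>" "\<And>g. g \<in> carrier G \<Longrightarrow> \<alpha> g = mat_trace (\<rho> g)"
  shows "is_character \<alpha>"
  using assms unfolding is_character_def by blast

lemma is_characterE:
  assumes "is_character \<alpha>"
  obtains d \<rho> where "is_rep G d \<rho>" "\<And>g. g \<in> carrier G \<Longrightarrow> \<alpha> g = mat_trace (\<rho> g)"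
  using assms unfolding is_character_def by blast

lemma is_character_one: "is_character (\<lambda>_. 1)"
  by (rule is_characterI[of 1 "\<lambda>_. 1\<^sub>m 1"]) (auto simp: is_rep_def)

lemma is_character_mult:
  assumes "is_character \<alpha>" "is_character \<beta>"
  shows "is_character (\<lambda>g. \<alpha> g * \<beta> g)"
proof -
  from assms(1) obtain d \<rho> where \<rho>: "is_rep G d \<rho>" "\<And>g. g \<in> carrier G \<Longrightarrow> \<alpha> g = mat_trace (\<rho> g)"
    by (elim is_characterE) blast
  from assms(2) obtain e \<sigma> where \<sigma>: "is_rep G e \<sigma>" "\<And>g. g \<in> carrier G \<Longrightarrow> \<beta> g = mat_trace (\<sigma> g)"
    by (elim is_characterE) blast
  note carrier = rep_carrier[OF \<rho>(1)] rep_carrier[OF \<sigma>(1)]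
  show ?thesis
  proof (rule is_characterI)
    show "is_rep G (d * e) (\<lambda>g. kronecker_mat (\<rho> g) (\<sigma> g))"
      unfolding is_rep_def
      by (simp add: carrier rep_one[OF \<rho>(1)] rep_one[OF \<sigma>(1)] kronecker_mat_one
          rep_mult[OF \<rho>(1)] rep_mult[OF \<sigma>(1)] kronecker_mat_mult[OF carrier carrier])
    fix g assume "g \<in> carrier G"
    thus "\<alpha> g * \<beta> g = mat_trace (kronecker_mat (\<rho> g) (\<sigma> g))"
      by (simp add: \<rho>(2) \<sigma>(2) mat_trace_kronecker_mat[OF carrier])
  qed
qed

lemma is_character_prod:
  assumes "\<And>i. i \<in> I \<Longrightarrow> is_character (\<alpha> i)"
  shows "is_character (\<lambda>g. \<Prod>i\<in>I. \<alpha> i g)"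
  using assms by (induction I rule: infinite_finite_induct) (auto intro: is_character_one is_character_mult)

lemma is_character_cnj:
  assumes "is_character \<alpha>"
  shows "is_character (\<lambda>g. cnj (\<alpha> g))"
proof -
  from assms obtain d \<rho> where \<rho>: "is_rep G d \<rho>" "\<And>g. g \<in> carrier G \<Longrightarrow> \<alpha> g = mat_trace (\<rho> g)"
    by (elim is_characterE) blast
  note carrier = rep_carrier[OF \<rho>(1)]
  interpret cnj: semiring_hom cnj by standard auto
  show ?thesis
  proof (rule is_characterI)
    show "is_rep G d (\<lambda>g. map_mat cnj (\<rho> g))"
      unfolding is_rep_def
      by (auto simp: carrier rep_one[OF \<rho>(1)] cnj.mat_hom_one rep_mult[OF \<rho>(1)] cnj.mat_hom_mult[OF carrier carrier])
    fix g assume g: "g \<in> carrier G"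
    thus "cnj (\<alpha> g) = mat_trace (map_mat cnj (\<rho> g))"
      using carrier[OF g] by (simp add: \<rho>(2) mat_trace_eq_sum[of _ d])
  qed
qed

lemma is_character_cyclotomic: "is_character \<alpha> \<Longrightarrow> g \<in> carrier G \<Longrightarrow> \<alpha> g \<in> cyclotomic_ints (order G)"
  and is_character_inv: "is_character \<alpha> \<Longrightarrow> g \<in> carrier G \<Longrightarrow> \<alpha> (inv g) = cnj (\<alpha> g)"
  by (auto simp: rep_trace_cyclotomic rep_trace_inv elim!: is_characterE)

lemma is_character_class_function:
  assumes "is_character \<alpha>"
  shows "class_function \<alpha>"
  unfolding class_function_def
proof (intro ballI)
  fix x g assume xg: "x \<in> carrier G" "g \<in> carrier G"
  from assms obtain d \<rho> where rep: "is_rep G d \<rho>" and \<alpha>: "\<And>g. g \<in> carrier G \<Longrightarrow> \<alpha> g = mat_trace (\<rho> g)"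
    by (elim is_characterE) blast
  have "mat_trace (\<rho> (x \<otimes> g) * \<rho> (inv x)) = mat_trace (\<rho> (inv x) * \<rho> (x \<otimes> g))"
    using xg by (intro mat_trace_mult_commute[of _ d d] rep_carrier[OF rep]) auto
  thus "\<alpha> (x \<otimes> g \<otimes> inv x) = \<alpha> g"
    using xg by (simp add: \<alpha> m_assoc[symmetric] flip: rep_mult[OF rep])
qed

lemma cf_inner_character_Ints:
  assumes "is_character \<alpha>" "is_character \<beta>"
  shows "cf_inner G \<alpha> \<beta> \<in> \<int>"
proof -
  from is_character_mult[OF assms(1) is_character_cnj[OF assms(2)]] obtain d \<rho>
    where rep: "is_rep G d \<rho>" and "\<And>g. g \<in> carrier G \<Longrightarrow> \<alpha> g * cnj (\<beta> g) = mat_trace (\<rho> g)"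
    by (elim is_characterE) blast
  thus ?thesis using average_rep_trace_Ints[OF rep] by (simp add: cf_inner_def order_def)
qed

lemma is_character_Irr:
  assumes "\<chi> \<in> Irr G"
  shows "is_character \<chi>"
proof -
  from assms obtain d \<rho> where "is_irr_rep G d \<rho>" "\<chi> = character G \<rho>" unfolding Irr_def by blast
  thus ?thesis by (intro is_characterI[of d \<rho>]) (auto simp: is_irr_rep_def character_def)
qed

end

section \<open>Schur's lemma and orthogonality\<close>

lemma is_subspace_mat_kernel:
  assumes T: "T \<in> carrier_mat m n"
  shows "is_subspace n (mat_kernel T)"
  unfolding is_subspace_def mat_kernel[OF T]
  using T by (auto simp: mult_mat_zero_vec mult_add_distrib_mat_vec mult_mat_vec)

lemma is_subspace_range_mult_mat_vec:
  assumes T: "T \<in> carrier_mat m n"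
  shows "is_subspace m ((*\<^sub>v) T ` carrier_vec n)"
  unfolding is_subspace_def
proof (intro conjI ballI allI)
  show "(*\<^sub>v) T ` carrier_vec n \<subseteq> carrier_vec m" using T by auto
  show "0\<^sub>v m \<in> (*\<^sub>v) T ` carrier_vec n"
    using T by (intro image_eqI[of _ _ "0\<^sub>v n"]) (auto simp: mult_mat_zero_vec)
next
  fix v w assume "v \<in> (*\<^sub>v) T ` carrier_vec n" "w \<in> (*\<^sub>v) T ` carrier_vec n"
  then obtain v' w' where "v' \<in> carrier_vec n" "w' \<in> carrier_vec n" "v = T *\<^sub>v v'" "w = T *\<^sub>v w'" by blast
  thus "v + w \<in> (*\<^sub>v) T ` carrier_vec n"
    using T by (intro image_eqI[of _ _ "v' + w'"]) (auto simp: mult_add_distrib_mat_vec)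
next
  fix c v assume "v \<in> (*\<^sub>v) T ` carrier_vec n"
  then obtain v' where "v' \<in> carrier_vec n" "v = T *\<^sub>v v'" by blast
  thus "c \<cdot>\<^sub>v v \<in> (*\<^sub>v) T ` carrier_vec n"
    using T by (intro image_eqI[of _ _ "c \<cdot>\<^sub>v v'"]) (auto simp: mult_mat_vec)
qed

lemma inj_on_mult_mat_vec:
  fixes T :: "'a :: comm_ring_1 mat"
  assumes T: "T \<in> carrier_mat m n" and kernel: "mat_kernel T = {0\<^sub>v n}"
  shows "inj_on ((*\<^sub>v) T) (carrier_vec n)"
proof (rule inj_onI)
  fix v w assume vw: "v \<in> carrier_vec n" "w \<in> carrier_vec n" and eq: "T *\<^sub>v v = T *\<^sub>v w"
  have "T *\<^sub>v (v - w) = 0\<^sub>v m" using T vw by (simp add: mult_minus_distrib_mat_vec eq)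
  hence "v - w \<in> mat_kernel T" using T vw by (intro mat_kernelI) auto
  hence "v - w = 0\<^sub>v n" by (simp add: kernel)
  thus "v = w" using vw by (auto simp: vec_eq_iff)
qed

lemma eq_smult_one_if_char_matrix_zero:
  fixes A :: "'a :: field mat"
  assumes A: "A \<in> carrier_mat n n" and zero: "char_matrix A c = 0\<^sub>m n n"
  shows "A = c \<cdot>\<^sub>m 1\<^sub>m n"
proof (rule eq_matI)
  fix i j assume "i < dim_row (c \<cdot>\<^sub>m 1\<^sub>m n)" "j < dim_col (c \<cdot>\<^sub>m 1\<^sub>m n)"
  hence ij: "i < n" "j < n" by auto
  hence "char_matrix A c $$ (i, j) = 0" by (simp add: zero)
  thus "A $$ (i, j) = (c \<cdot>\<^sub>m 1\<^sub>m n) $$ (i, j)"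
    using A ij by (auto simp: char_matrix_def split: if_splits)
qed (use A in auto)

context group
begin

definition invariant_subspace :: "nat \<Rightarrow> ('a \<Rightarrow> complex mat) \<Rightarrow> complex vec set \<Rightarrow> bool" where
  "invariant_subspace d \<rho> W \<longleftrightarrow> is_subspace d W \<and> (\<forall>g\<in>carrier G. \<forall>w\<in>W. \<rho> g *\<^sub>v w \<in> W)"

lemma is_irr_rep_iff:
  "is_irr_rep G d \<rho> \<longleftrightarrow> is_rep G d \<rho> \<and> d > 0 \<and>
     (\<forall>W. invariant_subspace d \<rho> W \<longrightarrow> W = {0\<^sub>v d} \<or> W = carrier_vec d)"
  unfolding is_irr_rep_def invariant_subspace_def by blast

lemma irr_rep_is_rep: "is_irr_rep G d \<rho> \<Longrightarrow> is_rep G d \<rho>"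
  and irr_rep_dim_pos: "is_irr_rep G d \<rho> \<Longrightarrow> d > 0"
  and irr_rep_invariant_subspace:
    "is_irr_rep G d \<rho> \<Longrightarrow> invariant_subspace d \<rho> W \<Longrightarrow> W = {0\<^sub>v d} \<or> W = carrier_vec d"
  by (auto simp: is_irr_rep_iff)

definition intertwiner ::
  "nat \<Rightarrow> ('a \<Rightarrow> complex mat) \<Rightarrow> nat \<Rightarrow> ('a \<Rightarrow> complex mat) \<Rightarrow> complex mat \<Rightarrow> bool" where
  "intertwiner d \<rho> e \<sigma> T \<longleftrightarrow> T \<in> carrier_mat d e \<and> (\<forall>g\<in>carrier G. \<rho> g * T = T * \<sigma> g)"

context
  fixes d e \<rho> \<sigma> T
  assumes \<rho>: "is_rep G d \<rho>" and \<sigma>: "is_rep G e \<sigma>" and T: "intertwiner d \<rho> e \<sigma> T"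
begin

lemma intertwiner_carrier: "T \<in> carrier_mat d e"
  using T by (simp add: intertwiner_def)

lemma intertwiner_commute_vec:
  assumes g: "g \<in> carrier G" and v: "v \<in> carrier_vec e"
  shows "\<rho> g *\<^sub>v (T *\<^sub>v v) = T *\<^sub>v (\<sigma> g *\<^sub>v v)"
proof -
  have "\<rho> g *\<^sub>v (T *\<^sub>v v) = (\<rho> g * T) *\<^sub>v v"
    using assoc_mult_mat_vec[OF rep_carrier[OF \<rho> g] intertwiner_carrier v] by simp
  also have "\<rho> g * T = T * \<sigma> g" using T g by (simp add: intertwiner_def)
  also have "(T * \<sigma> g) *\<^sub>v v = T *\<^sub>v (\<sigma> g *\<^sub>v v)"
    by (rule assoc_mult_mat_vec[OF intertwiner_carrier rep_carrier[OF \<sigma> g] v])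
  finally show ?thesis .
qed

lemma intertwiner_kernel_invariant: "invariant_subspace e \<sigma> (mat_kernel T)"
  unfolding invariant_subspace_def
proof (intro conjI ballI)
  show "is_subspace e (mat_kernel T)" by (rule is_subspace_mat_kernel[OF intertwiner_carrier])
  fix g w assume g: "g \<in> carrier G" and "w \<in> mat_kernel T"
  hence w: "w \<in> carrier_vec e" "T *\<^sub>v w = 0\<^sub>v d" using mat_kernelD[OF intertwiner_carrier] by auto
  hence "T *\<^sub>v (\<sigma> g *\<^sub>v w) = 0\<^sub>v d"
    using mult_mat_zero_vec[OF rep_carrier[OF \<rho> g]] by (simp flip: intertwiner_commute_vec[OF g])
  thus "\<sigma> g *\<^sub>v w \<in> mat_kernel T"
    using w rep_carrier[OF \<sigma> g] by (intro mat_kernelI[OF intertwiner_carrier]) auto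
qed

lemma intertwiner_range_invariant: "invariant_subspace d \<rho> ((*\<^sub>v) T ` carrier_vec e)"
  unfolding invariant_subspace_def
  using is_subspace_range_mult_mat_vec[OF intertwiner_carrier] rep_carrier[OF \<sigma>]
  by (auto simp: intertwiner_commute_vec intro!: imageI mult_mat_vec_carrier)

end

lemma schur_bij_betw:
  assumes irr: "is_irr_rep G d \<rho>" "is_irr_rep G e \<sigma>"
    and T: "intertwiner d \<rho> e \<sigma> T" and nonzero: "T \<noteq> 0\<^sub>m d e"
  shows "bij_betw ((*\<^sub>v) T) (carrier_vec e) (carrier_vec d)"
proof -
  note reps = irr_rep_is_rep[OF irr(1)] irr_rep_is_rep[OF irr(2)]
  note T_carrier = intertwiner_carrier[OF reps T]
  have not_null: "\<not> (\<forall>v\<in>carrier_vec e. T *\<^sub>v v = 0\<^sub>v d)"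
  proof
    assume "\<forall>v\<in>carrier_vec e. T *\<^sub>v v = 0\<^sub>v d"
    hence "T = 0\<^sub>m d e" by (intro eq_mat_if_mult_vec_eq[OF T_carrier]) auto
    thus False using nonzero by simp
  qed
  have "mat_kernel T \<noteq> carrier_vec e"
    using not_null by (auto simp: mat_kernel[OF T_carrier])
  hence "mat_kernel T = {0\<^sub>v e}"
    using irr_rep_invariant_subspace[OF irr(2) intertwiner_kernel_invariant[OF reps T]] by blast
  moreover have "(*\<^sub>v) T ` carrier_vec e \<noteq> {0\<^sub>v d}"
    using not_null by blast
  hence "(*\<^sub>v) T ` carrier_vec e = carrier_vec d"
    using irr_rep_invariant_subspace[OF irr(1) intertwiner_range_invariant[OF reps T]] by blast
  ultimately show ?thesis using inj_on_mult_mat_vec[OF T_carrier] by (simp add: bij_betw_def)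
qed

lemma schur_character_eq:
  assumes irr: "is_irr_rep G d \<rho>" "is_irr_rep G e \<sigma>"
    and T: "intertwiner d \<rho> e \<sigma> T" and "T \<noteq> 0\<^sub>m d e"
  shows "character G \<rho> = character G \<sigma>"
proof
  fix g
  note reps = irr_rep_is_rep[OF irr(1)] irr_rep_is_rep[OF irr(2)]
  note T_carrier = intertwiner_carrier[OF reps T]
  obtain S where S: "S \<in> carrier_mat e d" "T * S = 1\<^sub>m d" "S * T = 1\<^sub>m e"
    by (rule two_sided_inverse_if_bij_betw[OF T_carrier schur_bij_betw[OF assms]])
  have "mat_trace (\<rho> g) = mat_trace (\<sigma> g)" if g: "g \<in> carrier G"
  proof -
    note carrier = rep_carrier[OF reps(1) g] rep_carrier[OF reps(2) g]
    have "mat_trace (\<rho> g) = mat_trace (\<rho> g * T * S)"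
      using assoc_mult_mat[OF carrier(1) T_carrier S(1)] S(2) carrier(1) by simp
    also have "\<rho> g * T = T * \<sigma> g" using T g by (simp add: intertwiner_def)
    also have "mat_trace (T * \<sigma> g * S) = mat_trace (S * (T * \<sigma> g))"
      using T_carrier carrier S(1) by (intro mat_trace_mult_commute[of _ d e]) auto
    also have "S * (T * \<sigma> g) = \<sigma> g"
      using assoc_mult_mat[OF S(1) T_carrier carrier(2)] S(3) carrier(2) by simp
    finally show ?thesis .
  qed
  thus "character G \<rho> g = character G \<sigma> g" by (simp add: character_def)
qed

lemma intertwiner_char_matrix:
  assumes rep: "is_rep G d \<rho>" and T: "intertwiner d \<rho> d \<rho> T"
  shows "intertwiner d \<rho> d \<rho> (char_matrix T c)"
  unfolding intertwiner_def
proof (intro conjI ballI)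
  note T_carrier = intertwiner_carrier[OF rep rep T]
  show "char_matrix T c \<in> carrier_mat d d" using T_carrier by simp
  fix g assume g: "g \<in> carrier G"
  hence "\<rho> g * T = T * \<rho> g" using T by (simp add: intertwiner_def)
  thus "\<rho> g * char_matrix T c = char_matrix T c * \<rho> g"
    using T_carrier rep_carrier[OF rep g]
    by (simp add: char_matrix_def mult_add_distrib_mat[of _ d d] add_mult_distrib_mat[of _ d d]
        mult_smult_distrib[of _ d d _ d] mult_smult_assoc_mat[of _ d d _ d])
qed

lemma schur_scalar:
  assumes irr: "is_irr_rep G d \<rho>" and T: "intertwiner d \<rho> d \<rho> T"
  shows "T = (mat_trace T / of_nat d) \<cdot>\<^sub>m 1\<^sub>m d"
proof -
  note rep = irr_rep_is_rep[OF irr]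
  note T_carrier = intertwiner_carrier[OF rep rep T]
  from spectrum_non_empty[OF T_carrier irr_rep_dim_pos[OF irr]] obtain c v where "eigenvector T v c"
    unfolding spectrum_def eigenvalue_def by blast
  hence "v \<in> mat_kernel (char_matrix T c)" "v \<noteq> 0\<^sub>v d"
    using T_carrier by (auto simp: eigenvector_char_matrix[OF T_carrier] mat_kernel[of _ d d])
  hence "mat_kernel (char_matrix T c) = carrier_vec d"
    using intertwiner_kernel_invariant[OF rep rep intertwiner_char_matrix[OF rep T]]
      irr_rep_invariant_subspace[OF irr]
    by blast
  hence "char_matrix T c *\<^sub>v w = 0\<^sub>m d d *\<^sub>v w" if "w \<in> carrier_vec d" for w
    using mat_kernelD[OF char_matrix_closed[OF T_carrier]] that by auto
  hence "char_matrix T c = 0\<^sub>m d d"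
    using T_carrier by (intro eq_mat_if_mult_vec_eq[of _ d d]) auto
  hence scalar: "T = c \<cdot>\<^sub>m 1\<^sub>m d" by (rule eq_smult_one_if_char_matrix_zero[OF T_carrier])
  hence "mat_trace T = c * of_nat d" using mat_trace_smult[OF one_carrier_mat, of c d] by simp
  thus ?thesis using scalar irr_rep_dim_pos[OF irr] by simp
qed

end

context finite_group
begin

definition conjugation_sum ::
  "nat \<Rightarrow> ('a \<Rightarrow> complex mat) \<Rightarrow> nat \<Rightarrow> ('a \<Rightarrow> complex mat) \<Rightarrow> complex mat \<Rightarrow> complex mat" where
  "conjugation_sum d \<rho> e \<sigma> X = mat_sum d e (\<lambda>g. \<rho> g * X * \<sigma> (inv g)) (carrier G)"

lemma intertwiner_conjugation_sum:
  assumes \<rho>: "is_rep G d \<rho>" and \<sigma>: "is_rep G e \<sigma>" and X: "X \<in> carrier_mat d e"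
  shows "intertwiner d \<rho> e \<sigma> (conjugation_sum d \<rho> e \<sigma> X)"
  unfolding intertwiner_def
proof (intro conjI ballI)
  note carrier = rep_carrier[OF \<rho>] rep_carrier[OF \<sigma>]
  fix h assume h: "h \<in> carrier G"
  have "\<rho> h * conjugation_sum d \<rho> e \<sigma> X = mat_sum d e (\<lambda>g. \<rho> h * (\<rho> g * X * \<sigma> (inv g))) (carrier G)"
    unfolding conjugation_sum_def by (rule mult_mat_sum) (use carrier h X in \<open>auto intro!: mult_carrier_mat\<close>)
  also have "\<dots> = mat_sum d e (\<lambda>g. \<rho> (h \<otimes> g) * X * \<sigma> (inv (h \<otimes> g) \<otimes> h)) (carrier G)"
  proof (rule mat_sum_cong)
    fix g assume g: "g \<in> carrier G"
    have "inv (h \<otimes> g) \<otimes> h = inv g" using g h by (simp add: inv_mult_group m_assoc)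
    thus "\<rho> h * (\<rho> g * X * \<sigma> (inv g)) = \<rho> (h \<otimes> g) * X * \<sigma> (inv (h \<otimes> g) \<otimes> h)"
      using carrier g h X
      by (simp add: rep_mult[OF \<rho>] assoc_mult_mat[of _ d d _ d _ e]
          assoc_mult_mat[of _ d d _ e _ e] mult_carrier_mat[of _ d d _ e])
  qed
  also have "\<dots> = mat_sum d e (\<lambda>g. \<rho> g * X * \<sigma> (inv g \<otimes> h)) (carrier G)"
    by (rule mat_sum_reindex_bij_betw[OF bij_betw_l_mult[OF h]])
  also have "\<dots> = mat_sum d e (\<lambda>g. \<rho> g * X * \<sigma> (inv g) * \<sigma> h) (carrier G)"
  proof (rule mat_sum_cong)
    fix g assume g: "g \<in> carrier G"
    show "\<rho> g * X * \<sigma> (inv g \<otimes> h) = \<rho> g * X * \<sigma> (inv g) * \<sigma> h"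
      using carrier g h X
      by (simp add: rep_mult[OF \<sigma>] assoc_mult_mat[of _ d e _ e _ e] mult_carrier_mat[of _ d d _ e])
  qed
  also have "\<dots> = conjugation_sum d \<rho> e \<sigma> X * \<sigma> h"
    unfolding conjugation_sum_def
    by (rule mat_sum_mult[symmetric]) (use carrier h X in \<open>auto intro!: mult_carrier_mat\<close>)
  finally show "\<rho> h * conjugation_sum d \<rho> e \<sigma> X = conjugation_sum d \<rho> e \<sigma> X * \<sigma> h" .
qed (simp add: conjugation_sum_def)

lemma conjugation_sum_eq_zero:
  assumes irr: "is_irr_rep G d \<rho>" "is_irr_rep G e \<sigma>" and neq: "character G \<rho> \<noteq> character G \<sigma>"
    and X: "X \<in> carrier_mat d e"
  shows "conjugation_sum d \<rho> e \<sigma> X = 0\<^sub>m d e"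
  using schur_character_eq[OF irr] neq
    intertwiner_conjugation_sum[OF irr_rep_is_rep[OF irr(1)] irr_rep_is_rep[OF irr(2)] X] by blast

lemma conjugation_sum_eq_scalar:
  assumes irr: "is_irr_rep G d \<rho>" and X: "X \<in> carrier_mat d d"
  shows "conjugation_sum d \<rho> d \<rho> X = (of_nat (order G) * mat_trace X / of_nat d) \<cdot>\<^sub>m 1\<^sub>m d"
proof -
  note rep = irr_rep_is_rep[OF irr]
  note carrier = rep_carrier[OF rep]
  have "mat_trace (\<rho> g * X * \<rho> (inv g)) = mat_trace X" if g: "g \<in> carrier G" for g
  proof -
    have "mat_trace (\<rho> g * X * \<rho> (inv g)) = mat_trace (\<rho> (inv g) * (\<rho> g * X))"
      using carrier g X by (intro mat_trace_mult_commute[of _ d d] mult_carrier_mat[of _ d d]) auto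
    also have "\<rho> (inv g) * (\<rho> g * X) = \<rho> (inv g) * \<rho> g * X"
      using assoc_mult_mat[OF carrier carrier X] g by simp
    also have "\<rho> (inv g) * \<rho> g = 1\<^sub>m d"
      using g by (simp add: rep_one[OF rep] flip: rep_mult[OF rep])
    also have "1\<^sub>m d * X = X" using X by simp
    finally show ?thesis .
  qed
  hence "mat_trace (conjugation_sum d \<rho> d \<rho> X) = of_nat (order G) * mat_trace X"
    unfolding conjugation_sum_def using carrier X
    by (subst mat_trace_mat_sum) (auto simp: order_def intro!: mult_carrier_mat)
  thus ?thesis using schur_scalar[OF irr intertwiner_conjugation_sum[OF rep rep X]] by simp
qed

lemma cf_inner_character_eq:
  assumes \<rho>: "is_rep G d \<rho>" and \<sigma>: "is_rep G e \<sigma>"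
  shows "of_nat (order G) * cf_inner G (character G \<rho>) (character G \<sigma>)
    = (\<Sum>i<d. \<Sum>j<e. conjugation_sum d \<rho> e \<sigma> (matrix_unit d e i j) $$ (i, j))"
proof -
  have "of_nat (order G) * cf_inner G (character G \<rho>) (character G \<sigma>)
      = (\<Sum>g\<in>carrier G. mat_trace (\<rho> g) * mat_trace (\<sigma> (inv g)))"
    using order_pos by (simp add: cf_inner_def character_def rep_trace_inv[OF \<sigma>] order_def)
  also have "\<dots> = (\<Sum>g\<in>carrier G. \<Sum>i<d. \<Sum>j<e. (\<rho> g * matrix_unit d e i j * \<sigma> (inv g)) $$ (i, j))"
    by (intro sum.cong refl mat_trace_mult_mat_trace rep_carrier[OF \<rho>] rep_carrier[OF \<sigma>] inv_closed)
  also have "\<dots> = (\<Sum>i<d. \<Sum>j<e. \<Sum>g\<in>carrier G. (\<rho> g * matrix_unit d e i j * \<sigma> (inv g)) $$ (i, j))"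
    by (subst sum.swap) (intro sum.cong refl sum.swap)
  finally show ?thesis by (simp add: conjugation_sum_def index_mat_sum del: index_mult_mat)
qed

theorem Irr_orthonormal:
  assumes "\<chi> \<in> Irr G" "\<psi> \<in> Irr G"
  shows "cf_inner G \<chi> \<psi> = (if \<chi> = \<psi> then 1 else 0)"
proof (cases "\<chi> = \<psi>")
  case False
  from assms obtain d \<rho> e \<sigma> where irr: "is_irr_rep G d \<rho>" "is_irr_rep G e \<sigma>"
    and eq: "\<chi> = character G \<rho>" "\<psi> = character G \<sigma>" unfolding Irr_def by blast
  have "of_nat (order G) * cf_inner G \<chi> \<psi> = 0"
    using conjugation_sum_eq_zero[OF irr] False
    unfolding eq cf_inner_character_eq[OF irr_rep_is_rep[OF irr(1)] irr_rep_is_rep[OF irr(2)]] by simp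
  thus ?thesis using order_pos False by simp
next
  case True
  from assms obtain d \<rho> where irr: "is_irr_rep G d \<rho>" and eq: "\<chi> = character G \<rho>"
    unfolding Irr_def by blast
  note rep = irr_rep_is_rep[OF irr]
  have "of_nat (order G) * cf_inner G \<chi> \<chi> = (\<Sum>i<d. \<Sum>j<d. if i = j then of_nat (order G) / of_nat d else 0)"
    unfolding eq cf_inner_character_eq[OF rep rep]
    by (intro sum.cong refl) (auto simp: conjugation_sum_eq_scalar[OF irr] mat_trace_matrix_unit)
  also have "\<dots> = of_nat (order G)" using irr_rep_dim_pos[OF irr] by simp
  finally show ?thesis using order_pos True by simp
qed

end

section \<open>Completeness of the irreducible characters\<close>

subsection \<open>Reducible representations\<close>

lemma subspace_mult_mat_vec:
  assumes W: "is_subspace m W" and A: "A \<in> carrier_mat m n" and v: "v \<in> carrier_vec n"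
    and cols: "\<And>j. j < n \<Longrightarrow> v $ j \<noteq> 0 \<Longrightarrow> col A j \<in> W"
  shows "A *\<^sub>v v \<in> W"
proof -
  define t where "t k = vec n (\<lambda>j. if j < k then v $ j else 0)" for k
  have t: "t k \<in> carrier_vec n" for k by (simp add: t_def)
  have "A *\<^sub>v t k \<in> W" if "k \<le> n" for k
    using that
  proof (induction k)
    case 0
    have "t 0 = 0\<^sub>v n" by (auto simp: t_def)
    thus ?case using W mult_mat_zero_vec[OF A] by (simp add: is_subspace_def)
  next
    case (Suc k)
    have "t (Suc k) = t k + v $ k \<cdot>\<^sub>v unit_vec n k"
      using Suc.prems by (intro eq_vecI) (auto simp: t_def less_Suc_eq)
    hence step: "A *\<^sub>v t (Suc k) = A *\<^sub>v t k + v $ k \<cdot>\<^sub>v col A k"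
      using A t[of k] Suc.prems by (simp add: mult_add_distrib_mat_vec mult_mat_vec mult_mat_unit_vec)
    show ?case
    proof (cases "v $ k = 0")
      case True
      have "0 \<cdot>\<^sub>v col A k = 0\<^sub>v m" using A by (intro eq_vecI) auto
      thus ?thesis using True step Suc A t[of k] by simp
    next
      case False
      thus ?thesis using step Suc cols[of k] W by (simp add: is_subspace_def)
    qed
  qed
  moreover have "t n = v" using v by (intro eq_vecI) (auto simp: t_def)
  ultimately show ?thesis by force
qed

lemma exchange_column:
  fixes P :: "'a :: field mat"
  assumes P: "P \<in> carrier_mat n n" "det P \<noteq> 0" and v: "v \<in> carrier_vec n"
    and i: "k \<le> i" "i < n" "v $ i \<noteq> 0"
  obtains R where "R \<in> carrier_mat n n" "det R \<noteq> 0" "col R k = P *\<^sub>v v" "\<And>j. j < k \<Longrightarrow> col R j = col P j"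
proof -
  define S where "S = replace_col P (P *\<^sub>v v) i"
  have S: "S \<in> carrier_mat n n" using P by (simp add: S_def replace_col_def)
  have "det S = v $ i * det P" unfolding S_def by (rule cramer_lemma_mat[OF P(1) v i(2)])
  moreover have "det (swapcols k i S) = det S \<or> det (swapcols k i S) = - det S"
  proof (cases "k = i")
    case True
    hence "swapcols k i S = S" using S by (intro eq_matI) auto
    thus ?thesis by simp
  qed (use det_swapcols[of k n i S] i S in auto)
  ultimately have "det (swapcols k i S) \<noteq> 0" using i P(2) by auto
  moreover have "col (swapcols k i S) k = P *\<^sub>v v"
    using P S i by (intro eq_vecI) (auto simp: S_def replace_col_def)
  moreover have "col (swapcols k i S) j = col P j" if "j < k" for j
    using P S i that by (intro eq_vecI) (auto simp: S_def replace_col_def)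
  ultimately show thesis using that[of "swapcols k i S"] S by simp
qed

text \<open>Take an invertible matrix with as many leading columns in the subspace as possible: a vector of
  the subspace outside their span could be exchanged for a later column.\<close>

lemma subspace_leading_columns:
  assumes W: "is_subspace d W"
  obtains k P where "k \<le> d" "P \<in> carrier_mat d d" "det P \<noteq> 0"
    and "\<And>v. v \<in> carrier_vec d \<Longrightarrow> P *\<^sub>v v \<in> W \<longleftrightarrow> (\<forall>i. k \<le> i \<and> i < d \<longrightarrow> v $ i = 0)"
proof -
  define leading where
    "leading k \<longleftrightarrow> k \<le> d \<and> (\<exists>P\<in>carrier_mat d d. det P \<noteq> 0 \<and> (\<forall>j<k. col P j \<in> W))" for k
  have "leading 0" unfolding leading_def by (auto intro!: bexI[of _ "1\<^sub>m d"])
  moreover have "\<not> leading (Suc d)" by (simp add: leading_def)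
  ultimately obtain k where k: "leading k" "\<not> leading (Suc k)"
    using nat_induct[of leading] by blast
  then obtain P where P: "k \<le> d" "P \<in> carrier_mat d d" "det P \<noteq> 0" and cols: "\<And>j. j < k \<Longrightarrow> col P j \<in> W"
    unfolding leading_def by blast
  have "v $ i = 0" if v: "v \<in> carrier_vec d" "P *\<^sub>v v \<in> W" and i: "k \<le> i" "i < d" for v i
  proof (rule ccontr)
    assume "v $ i \<noteq> 0"
    then obtain R where R: "R \<in> carrier_mat d d" "det R \<noteq> 0" "col R k = P *\<^sub>v v"
      and "\<And>j. j < k \<Longrightarrow> col R j = col P j"
      using exchange_column[OF P(2,3) v(1) i] by blast
    hence "\<forall>j<Suc k. col R j \<in> W" using v(2) cols by (simp add: less_Suc_eq)
    hence "leading (Suc k)" unfolding leading_def using R i by auto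
    thus False using k by simp
  qed
  moreover have "P *\<^sub>v v \<in> W" if "v \<in> carrier_vec d" "\<forall>i. k \<le> i \<and> i < d \<longrightarrow> v $ i = 0" for v
    using that cols by (intro subspace_mult_mat_vec[OF W P(2)]) (auto simp flip: not_le)
  ultimately show thesis using that[OF P] by blast
qed

lemma proper_subspace_coordinates:
  assumes W: "is_subspace d W" and proper: "W \<noteq> {0\<^sub>v d}" "W \<noteq> carrier_vec d"
  obtains k P Q where "0 < k" "k < d" "P \<in> carrier_mat d d" "Q \<in> carrier_mat d d"
    and "P * Q = 1\<^sub>m d" "Q * P = 1\<^sub>m d"
    and "\<And>w. w \<in> carrier_vec d \<Longrightarrow> w \<in> W \<longleftrightarrow> (\<forall>i. k \<le> i \<and> i < d \<longrightarrow> (Q *\<^sub>v w) $ i = 0)"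
proof -
  from subspace_leading_columns[OF W] obtain k P
    where k: "k \<le> d" and P: "P \<in> carrier_mat d d" "det P \<noteq> 0"
      and leading: "\<And>v. v \<in> carrier_vec d \<Longrightarrow> P *\<^sub>v v \<in> W \<longleftrightarrow> (\<forall>i. k \<le> i \<and> i < d \<longrightarrow> v $ i = 0)"
    by metis
  obtain Q where Q: "Q \<in> carrier_mat d d" "P * Q = 1\<^sub>m d" "Q * P = 1\<^sub>m d"
    using two_sided_inverse_if_det_nonzero[OF P] .
  have PQ: "P *\<^sub>v (Q *\<^sub>v w) = w" if "w \<in> carrier_vec d" for w
    using assoc_mult_mat_vec[OF P(1) Q(1) that] Q(2) that by simp
  have coords: "w \<in> W \<longleftrightarrow> (\<forall>i. k \<le> i \<and> i < d \<longrightarrow> (Q *\<^sub>v w) $ i = 0)" if "w \<in> carrier_vec d" for w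
    using leading[of "Q *\<^sub>v w"] PQ[OF that] Q(1) that by simp
  have sub: "W \<subseteq> carrier_vec d" "0\<^sub>v d \<in> W" using W by (auto simp: is_subspace_def)
  have "k \<noteq> d" using coords proper(2) sub(1) by auto
  moreover have "k \<noteq> 0"
  proof
    assume "k = 0"
    hence "Q *\<^sub>v w = 0\<^sub>v d" if "w \<in> W" for w
      using coords[of w] that sub(1) Q(1) by (intro eq_vecI) auto
    hence "w = 0\<^sub>v d" if "w \<in> W" for w
      using PQ[of w] that sub(1) mult_mat_zero_vec[OF P(1)] by auto
    thus False using proper(1) sub(2) by blast
  qed
  ultimately show thesis using that[OF _ _ P(1) Q coords] k by simp
qed

context group
begin

lemma rep_conjugate:
  assumes rep: "is_rep G d \<rho>" and P: "P \<in> carrier_mat d d" and Q: "Q \<in> carrier_mat d d"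
    and inverse: "P * Q = 1\<^sub>m d" "Q * P = 1\<^sub>m d"
  shows "is_rep G d (\<lambda>g. Q * \<rho> g * P)"
  unfolding is_rep_def
proof (intro conjI ballI)
  note carrier = rep_carrier[OF rep]
  show "Q * \<rho> \<one> * P = 1\<^sub>m d" using inverse Q rep_one[OF rep] by simp
  fix g assume g: "g \<in> carrier G"
  show "Q * \<rho> g * P \<in> carrier_mat d d" using P Q carrier[OF g] by simp
  fix h assume h: "h \<in> carrier G"
  note assoc = assoc_mult_mat[of _ d d _ d _ d]
  have "Q * \<rho> g * P * (Q * \<rho> h * P) = Q * \<rho> g * (P * Q) * \<rho> h * P"
    using P Q carrier[OF g] carrier[OF h] by (simp add: assoc)
  also have "\<dots> = Q * \<rho> (g \<otimes> h) * P"
    using P Q inverse carrier[OF g] carrier[OF h] by (simp add: assoc rep_mult[OF rep g h])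
  finally show "Q * \<rho> (g \<otimes> h) * P = Q * \<rho> g * P * (Q * \<rho> h * P)" ..
qed

lemma block_triangular_reps:
  assumes rep: "is_rep G (m + n) \<rho>"
    and block: "\<And>g. g \<in> carrier G \<Longrightarrow> \<rho> g = four_block_mat (A g) (B g) (0\<^sub>m n m) (D g)"
    and carrier: "\<And>g. g \<in> carrier G \<Longrightarrow> A g \<in> carrier_mat m m" "\<And>g. g \<in> carrier G \<Longrightarrow> B g \<in> carrier_mat m n"
      "\<And>g. g \<in> carrier G \<Longrightarrow> D g \<in> carrier_mat n n"
  shows "is_rep G m A" and "is_rep G n D"
proof -
  have "four_block_mat (A \<one>) (B \<one>) (0\<^sub>m n m) (D \<one>) = four_block_mat (1\<^sub>m m) (0\<^sub>m m n) (0\<^sub>m n m) (1\<^sub>m n)"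
    using rep_one[OF rep] by (simp add: block)
  hence blocks_one: "A \<one> = 1\<^sub>m m" "D \<one> = 1\<^sub>m n"
    using four_block_mat_eqD[OF _ carrier(1)[OF one_closed] one_carrier_mat
        carrier(3)[OF one_closed] one_carrier_mat] by blast+
  have blocks_mult: "A (g \<otimes> h) = A g * A h" "D (g \<otimes> h) = D g * D h" if gh: "g \<in> carrier G" "h \<in> carrier G" for g h
  proof -
    note carrier_g = carrier[OF gh(1)] and carrier_h = carrier[OF gh(2)]
    have "four_block_mat (A (g \<otimes> h)) (B (g \<otimes> h)) (0\<^sub>m n m) (D (g \<otimes> h))
        = four_block_mat (A g) (B g) (0\<^sub>m n m) (D g) * four_block_mat (A h) (B h) (0\<^sub>m n m) (D h)"
      using rep_mult[OF rep gh] gh by (simp add: block)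
    also have "\<dots> = four_block_mat (A g * A h) (A g * B h + B g * D h) (0\<^sub>m n m) (D g * D h)"
      using carrier_g carrier_h
        mult_four_block_mat[OF carrier_g(1,2) zero_carrier_mat carrier_g(3)
          carrier_h(1,2) zero_carrier_mat carrier_h(3)]
      by (simp add: left_add_zero_mat[of _ n n] right_add_zero_mat[of _ m m])
    finally show "A (g \<otimes> h) = A g * A h" "D (g \<otimes> h) = D g * D h"
      using four_block_mat_eqD[OF _ carrier(1)[OF m_closed[OF gh]] mult_carrier_mat[OF carrier_g(1) carrier_h(1)]
          carrier(3)[OF m_closed[OF gh]] mult_carrier_mat[OF carrier_g(3) carrier_h(3)]] by blast+
  qed
  show "is_rep G m A" "is_rep G n D" unfolding is_rep_def using blocks_one blocks_mult carrier by auto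
qed

lemma invariant_subspace_block_zero:
  assumes rep: "is_rep G d \<rho>" and W: "invariant_subspace d \<rho> W"
    and P: "P \<in> carrier_mat d d" and Q: "Q \<in> carrier_mat d d" and QP: "Q * P = 1\<^sub>m d"
    and coords: "\<And>w. w \<in> carrier_vec d \<Longrightarrow> w \<in> W \<longleftrightarrow> (\<forall>i. k \<le> i \<and> i < d \<longrightarrow> (Q *\<^sub>v w) $ i = 0)"
    and g: "g \<in> carrier G" and ij: "k \<le> i" "i < d" "j < k"
  shows "(Q * \<rho> g * P) $$ (i, j) = 0"
proof -
  note carrier = rep_carrier[OF rep g]
  have j: "j < d" using ij by simp
  define w where "w = P *\<^sub>v unit_vec d j"
  have w: "w \<in> carrier_vec d" using P by (simp add: w_def)
  have "Q *\<^sub>v w = unit_vec d j"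
    using assoc_mult_mat_vec[OF Q P, of "unit_vec d j"] by (simp add: w_def QP)
  hence "w \<in> W" using coords[OF w] ij by auto
  hence "\<rho> g *\<^sub>v w \<in> W" using W g by (simp add: invariant_subspace_def)
  hence "(Q *\<^sub>v (\<rho> g *\<^sub>v w)) $ i = 0" using coords[of "\<rho> g *\<^sub>v w"] carrier w ij by auto
  moreover have "Q *\<^sub>v (\<rho> g *\<^sub>v w) = (Q * \<rho> g) *\<^sub>v w" using assoc_mult_mat_vec[OF Q carrier w] by simp
  moreover have "\<dots> = (Q * \<rho> g * P) *\<^sub>v unit_vec d j"
    unfolding w_def by (rule assoc_mult_mat_vec[symmetric, OF _ P]) (use Q carrier in auto)
  moreover have "\<dots> = col (Q * \<rho> g * P) j"
    by (rule mult_mat_unit_vec[OF _ j, of _ d]) (use carrier P Q in simp)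
  ultimately show ?thesis using P Q ij j by simp
qed

lemma reducible_rep_block_triangular:
  assumes rep: "is_rep G d \<rho>" and d_pos: "d > 0" and reducible: "\<not> is_irr_rep G d \<rho>"
  obtains m n P Q A B D where "0 < m" "0 < n" "d = m + n"
    and "is_rep G (m + n) (\<lambda>g. Q * \<rho> g * P)"
    and "\<And>g. g \<in> carrier G \<Longrightarrow> similar_mat_wit (\<rho> g) (Q * \<rho> g * P) P Q"
    and "\<And>g. g \<in> carrier G \<Longrightarrow> Q * \<rho> g * P = four_block_mat (A g) (B g) (0\<^sub>m n m) (D g)"
    and "\<And>g. g \<in> carrier G \<Longrightarrow> A g \<in> carrier_mat m m" "\<And>g. g \<in> carrier G \<Longrightarrow> B g \<in> carrier_mat m n"
    and "\<And>g. g \<in> carrier G \<Longrightarrow> D g \<in> carrier_mat n n"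
proof -
  from reducible rep d_pos obtain W where W: "invariant_subspace d \<rho> W" "W \<noteq> {0\<^sub>v d}" "W \<noteq> carrier_vec d"
    unfolding is_irr_rep_iff by blast
  hence "is_subspace d W" by (simp add: invariant_subspace_def)
  from proper_subspace_coordinates[OF this W(2,3)] obtain m P Q
    where m: "0 < m" "m < d" and P: "P \<in> carrier_mat d d" and Q: "Q \<in> carrier_mat d d"
      and inverse: "P * Q = 1\<^sub>m d" "Q * P = 1\<^sub>m d"
      and coords: "\<And>w. w \<in> carrier_vec d \<Longrightarrow> w \<in> W \<longleftrightarrow> (\<forall>i. m \<le> i \<and> i < d \<longrightarrow> (Q *\<^sub>v w) $ i = 0)"
    by metis
  define n where "n = d - m"
  have n: "0 < n" "d = m + n" using m by (auto simp: n_def)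
  have conj_rep: "is_rep G d (\<lambda>g. Q * \<rho> g * P)" by (rule rep_conjugate[OF rep P Q inverse])
  have "\<exists>A B D. A \<in> carrier_mat m m \<and> B \<in> carrier_mat m n \<and> D \<in> carrier_mat n n
      \<and> Q * \<rho> g * P = four_block_mat A B (0\<^sub>m n m) D" if g: "g \<in> carrier G" for g
  proof -
    note carrier = rep_carrier[OF conj_rep g]
    obtain A B C D where blocks: "split_block (Q * \<rho> g * P) m m = (A, B, C, D)" by (metis prod_cases4)
    have "C = mat n m (\<lambda>(i, j). (Q * \<rho> g * P) $$ (i + m, j))"
      using blocks carrier_matD[OF carrier] by (auto simp: split_block_def Let_def n_def)
    also have "\<dots> = 0\<^sub>m n m"
      using invariant_subspace_block_zero[OF rep W(1) P Q inverse(2) coords g]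
      by (intro eq_matI) (auto simp: n_def simp del: index_mult_mat)
    finally show ?thesis using split_block[OF blocks, of n n] carrier_matD[OF carrier] n by auto
  qed
  then obtain A B D where blocks: "\<And>g. g \<in> carrier G \<Longrightarrow> A g \<in> carrier_mat m m"
    "\<And>g. g \<in> carrier G \<Longrightarrow> B g \<in> carrier_mat m n" "\<And>g. g \<in> carrier G \<Longrightarrow> D g \<in> carrier_mat n n"
    "\<And>g. g \<in> carrier G \<Longrightarrow> Q * \<rho> g * P = four_block_mat (A g) (B g) (0\<^sub>m n m) (D g)"
    by metis
  have "similar_mat_wit (\<rho> g) (Q * \<rho> g * P) P Q" if g: "g \<in> carrier G" for g
    by (rule similar_mat_wit_sym)
      (rule similar_mat_witI[OF inverse(2,1) refl rep_carrier[OF conj_rep g] rep_carrier[OF rep g] Q P])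
  thus thesis by (rule that[OF m(1) n conj_rep[unfolded n(2)] _ blocks(4,1,2,3)])
qed

lemma reducible_rep_trace:
  assumes rep: "is_rep G d \<rho>" and "d > 0" and "\<not> is_irr_rep G d \<rho>"
  obtains m n \<sigma> \<tau> where "m < d" "n < d" "is_rep G m \<sigma>" "is_rep G n \<tau>"
    and "\<And>g. g \<in> carrier G \<Longrightarrow> mat_trace (\<rho> g) = mat_trace (\<sigma> g) + mat_trace (\<tau> g)"
proof (rule reducible_rep_block_triangular[OF assms])
  fix m n P Q A B D
  assume dim: "0 < m" "0 < n" "d = m + n"
    and conj_rep: "is_rep G (m + n) (\<lambda>g. Q * \<rho> g * P)"
    and similar: "\<And>g. g \<in> carrier G \<Longrightarrow> similar_mat_wit (\<rho> g) (Q * \<rho> g * P) P Q"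
    and block: "\<And>g. g \<in> carrier G \<Longrightarrow> Q * \<rho> g * P = four_block_mat (A g) (B g) (0\<^sub>m n m) (D g)"
    and carrier: "\<And>g. g \<in> carrier G \<Longrightarrow> A g \<in> carrier_mat m m" "\<And>g. g \<in> carrier G \<Longrightarrow> B g \<in> carrier_mat m n"
      "\<And>g. g \<in> carrier G \<Longrightarrow> D g \<in> carrier_mat n n"
  show thesis
  proof (rule that[OF _ _ block_triangular_reps[OF conj_rep block carrier]])
    show "m < d" "n < d" using dim by auto
    fix g assume g: "g \<in> carrier G"
    show "mat_trace (\<rho> g) = mat_trace (A g) + mat_trace (D g)"
      using mat_trace_similar[OF rep_carrier[OF rep g] similar[OF g]]
        mat_trace_four_block_mat[OF carrier(1)[OF g] carrier(3)[OF g]]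
      by (simp add: block[OF g])
  qed
qed

end

subsection \<open>Completeness\<close>

context finite_group
begin

lemma is_character_regular: "is_character (\<lambda>g. if g = \<one> then of_nat (order G) else 0)"
proof -
  let ?n = "order G"
  from ex_bij_betw_nat_finite[OF finite_carrier] obtain b where b: "bij_betw b {..<?n} (carrier G)"
    by (auto simp: atLeast0LessThan order_def)
  have b_carrier: "b i \<in> carrier G" if "i < ?n" for i using b that by (auto simp: bij_betw_def)
  have b_eq_iff: "b i = b j \<longleftrightarrow> i = j" if "i < ?n" "j < ?n" for i j
    using b that by (auto simp: bij_betw_def inj_on_def)
  define \<rho> :: "'a \<Rightarrow> complex mat"
    where "\<rho> g = mat ?n ?n (\<lambda>(i, j). if b i = g \<otimes> b j then 1 else 0)" for g
  have \<rho>_carrier: "\<rho> g \<in> carrier_mat ?n ?n" for g by (simp add: \<rho>_def)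
  have "\<rho> (g \<otimes> h) = \<rho> g * \<rho> h" if gh: "g \<in> carrier G" "h \<in> carrier G" for g h
  proof (rule eq_matI)
    fix i j assume "i < dim_row (\<rho> g * \<rho> h)" "j < dim_col (\<rho> g * \<rho> h)"
    hence ij: "i < ?n" "j < ?n" by (auto simp: \<rho>_def)
    have "h \<otimes> b j \<in> b ` {..<?n}" using b gh b_carrier[OF ij(2)] by (simp add: bij_betw_def)
    then obtain l where l: "l < ?n" "h \<otimes> b j = b l" by auto
    have "(\<rho> g * \<rho> h) $$ (i, j) = (\<Sum>k<?n. if k = l then (if b i = g \<otimes> b l then 1 else 0) else 0)"
      unfolding index_mult_mat_sum[OF \<rho>_carrier \<rho>_carrier ij]
      by (intro sum.cong refl) (use ij l in \<open>auto simp: \<rho>_def b_eq_iff\<close>)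
    also have "\<dots> = \<rho> (g \<otimes> h) $$ (i, j)"
      using ij l gh b_carrier[OF ij(2)] by (simp add: \<rho>_def m_assoc)
    finally show "\<rho> (g \<otimes> h) $$ (i, j) = (\<rho> g * \<rho> h) $$ (i, j)" ..
  qed (auto simp: \<rho>_def)
  moreover have "\<rho> \<one> = 1\<^sub>m ?n" by (rule eq_matI) (auto simp: \<rho>_def b_carrier b_eq_iff)
  ultimately have "is_rep G ?n \<rho>" unfolding is_rep_def using \<rho>_carrier by blast
  thus ?thesis
  proof (rule is_characterI)
    fix g assume g: "g \<in> carrier G"
    have "b i = g \<otimes> b i \<longleftrightarrow> g = \<one>" if "i < ?n" for i
      using b_carrier[OF that] g by simp
    hence "mat_trace (\<rho> g) = (\<Sum>i<?n. if g = \<one> then 1 else 0)"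
      unfolding mat_trace_eq_sum[OF \<rho>_carrier] by (intro sum.cong refl) (simp add: \<rho>_def)
    thus "(if g = \<one> then of_nat ?n else 0) = mat_trace (\<rho> g)" by simp
  qed
qed

definition weighted_rep_sum :: "nat \<Rightarrow> ('a \<Rightarrow> complex mat) \<Rightarrow> ('a \<Rightarrow> complex) \<Rightarrow> complex mat" where
  "weighted_rep_sum d \<rho> f = mat_sum d d (\<lambda>g. f g \<cdot>\<^sub>m \<rho> (inv g)) (carrier G)"

lemma rep_mult_weighted_rep_sum:
  assumes rep: "is_rep G d \<rho>" and h: "h \<in> carrier G"
  shows "\<rho> h * weighted_rep_sum d \<rho> f = mat_sum d d (\<lambda>g. f g \<cdot>\<^sub>m \<rho> (h \<otimes> inv g)) (carrier G)"
proof -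
  note carrier = rep_carrier[OF rep]
  have "\<rho> h * weighted_rep_sum d \<rho> f = mat_sum d d (\<lambda>g. \<rho> h * (f g \<cdot>\<^sub>m \<rho> (inv g))) (carrier G)"
    unfolding weighted_rep_sum_def by (rule mult_mat_sum) (use carrier h in auto)
  also have "\<dots> = mat_sum d d (\<lambda>g. f g \<cdot>\<^sub>m \<rho> (h \<otimes> inv g)) (carrier G)"
    using carrier h by (intro mat_sum_cong) (simp add: rep_mult[OF rep] mult_smult_distrib[of _ d d _ d])
  finally show ?thesis .
qed

lemma intertwiner_weighted_rep_sum:
  assumes rep: "is_rep G d \<rho>" and f: "class_function f"
  shows "intertwiner d \<rho> d \<rho> (weighted_rep_sum d \<rho> f)"
  unfolding intertwiner_def
proof (intro conjI ballI)
  note carrier = rep_carrier[OF rep]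
  fix h assume h: "h \<in> carrier G"
  have "\<rho> h * weighted_rep_sum d \<rho> f = mat_sum d d (\<lambda>g. f g \<cdot>\<^sub>m \<rho> (h \<otimes> inv g)) (carrier G)"
    by (rule rep_mult_weighted_rep_sum[OF rep h])
  also have "\<dots> = mat_sum d d (\<lambda>g. f (h \<otimes> g \<otimes> inv h) \<cdot>\<^sub>m \<rho> (inv (h \<otimes> g \<otimes> inv h) \<otimes> h)) (carrier G)"
  proof (rule mat_sum_cong)
    fix g assume g: "g \<in> carrier G"
    have "inv (h \<otimes> g \<otimes> inv h) \<otimes> h = h \<otimes> inv g" using g h by (simp add: inv_mult_group m_assoc)
    thus "f g \<cdot>\<^sub>m \<rho> (h \<otimes> inv g) = f (h \<otimes> g \<otimes> inv h) \<cdot>\<^sub>m \<rho> (inv (h \<otimes> g \<otimes> inv h) \<otimes> h)"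
      using class_function_conjugate[OF f h g] by simp
  qed
  also have "\<dots> = mat_sum d d (\<lambda>g. f g \<cdot>\<^sub>m \<rho> (inv g \<otimes> h)) (carrier G)"
    by (rule mat_sum_reindex_bij_betw[OF bij_betw_conjugate[OF h]])
  also have "\<dots> = mat_sum d d (\<lambda>g. (f g \<cdot>\<^sub>m \<rho> (inv g)) * \<rho> h) (carrier G)"
    using carrier h by (intro mat_sum_cong) (simp add: rep_mult[OF rep] mult_smult_assoc_mat[of _ d d _ d])
  also have "\<dots> = weighted_rep_sum d \<rho> f * \<rho> h"
    unfolding weighted_rep_sum_def by (rule mat_sum_mult[symmetric]) (use carrier h in auto)
  finally show "\<rho> h * weighted_rep_sum d \<rho> f = weighted_rep_sum d \<rho> f * \<rho> h" .
qed (simp add: weighted_rep_sum_def)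

text \<open>By Schur's lemma, the element \<open>\<Sum>\<^sub>g f(g) g\<^sup>-\<^sup>1\<close> of the group algebra acts on an irreducible representation
  as a scalar of trace 0, hence as 0.\<close>

lemma irr_rep_translate_orthogonal:
  assumes irr: "is_irr_rep G d \<rho>" and f: "class_function f"
    and orth: "cf_inner G f (character G \<rho>) = 0" and h: "h \<in> carrier G"
  shows "(\<Sum>g\<in>carrier G. f g * mat_trace (\<rho> (h \<otimes> inv g))) = 0"
proof -
  note rep = irr_rep_is_rep[OF irr]
  note carrier = rep_carrier[OF rep]
  have "mat_trace (weighted_rep_sum d \<rho> f) = (\<Sum>g\<in>carrier G. f g * mat_trace (\<rho> (inv g)))"
    unfolding weighted_rep_sum_def using carrier by (simp add: mat_trace_mat_sum mat_trace_smult[of _ d])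
  also have "\<dots> = of_nat (order G) * cf_inner G f (character G \<rho>)"
    using order_pos by (simp add: cf_inner_def character_def rep_trace_inv[OF rep] order_def)
  finally have "mat_trace (weighted_rep_sum d \<rho> f) = 0" by (simp add: orth)
  hence "weighted_rep_sum d \<rho> f = 0 \<cdot>\<^sub>m 1\<^sub>m d"
    using schur_scalar[OF irr intertwiner_weighted_rep_sum[OF rep f]] by simp
  also have "\<dots> = 0\<^sub>m d d" by (rule eq_matI) auto
  finally have "mat_trace (\<rho> h * weighted_rep_sum d \<rho> f) = 0"
    using carrier[OF h] by (simp add: mat_trace_def)
  thus ?thesis
    unfolding rep_mult_weighted_rep_sum[OF rep h] using carrier h
    by (simp add: mat_trace_mat_sum mat_trace_smult[of _ d])
qed

lemma rep_translate_orthogonal: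
  assumes f: "class_function f" and orth: "\<And>\<chi>. \<chi> \<in> Irr G \<Longrightarrow> cf_inner G f \<chi> = 0"
    and h: "h \<in> carrier G" and rep: "is_rep G d \<rho>"
  shows "(\<Sum>g\<in>carrier G. f g * mat_trace (\<rho> (h \<otimes> inv g))) = 0"
  using rep
proof (induction d arbitrary: \<rho> rule: less_induct)
  case (less d)
  consider (zero) "d = 0" | (irreducible) "is_irr_rep G d \<rho>" | (reducible) "d > 0" "\<not> is_irr_rep G d \<rho>"
    by blast
  thus ?case
  proof cases
    case zero
    have "mat_trace (\<rho> (h \<otimes> inv g)) = 0" if "g \<in> carrier G" for g
      using rep_carrier[OF less.prems, of "h \<otimes> inv g"] h that zero by (simp add: mat_trace_def)
    thus ?thesis by simp
  next
    case irreducible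
    hence "character G \<rho> \<in> Irr G" unfolding Irr_def by blast
    thus ?thesis using irr_rep_translate_orthogonal[OF irreducible f orth h] by simp
  next
    case reducible
    then obtain m n \<sigma> \<tau> where dim: "m < d" "n < d" and reps: "is_rep G m \<sigma>" "is_rep G n \<tau>"
      and trace: "\<And>g. g \<in> carrier G \<Longrightarrow> mat_trace (\<rho> g) = mat_trace (\<sigma> g) + mat_trace (\<tau> g)"
      using reducible_rep_trace[OF less.prems] by metis
    have "(\<Sum>g\<in>carrier G. f g * mat_trace (\<rho> (h \<otimes> inv g)))
      = (\<Sum>g\<in>carrier G. f g * mat_trace (\<sigma> (h \<otimes> inv g))) + (\<Sum>g\<in>carrier G. f g * mat_trace (\<tau> (h \<otimes> inv g)))"
      using h by (simp add: trace distrib_left sum.distrib)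
    thus ?thesis using less.IH dim reps by simp
  qed
qed

theorem class_function_eq_zero_if_orthogonal:
  assumes f: "class_function f" and orth: "\<And>\<chi>. \<chi> \<in> Irr G \<Longrightarrow> cf_inner G f \<chi> = 0"
    and h: "h \<in> carrier G"
  shows "f h = 0"
proof -
  from is_character_regular obtain d \<rho> where rep: "is_rep G d \<rho>"
    and trace: "\<And>g. g \<in> carrier G \<Longrightarrow> (if g = \<one> then of_nat (order G) else 0) = mat_trace (\<rho> g)"
    by (elim is_characterE) blast
  have "h \<otimes> inv g = \<one> \<longleftrightarrow> g = h" if "g \<in> carrier G" for g
    using h that inv_unique' by (metis inv_closed inv_inv inv_equality r_inv)
  hence "f g * mat_trace (\<rho> (h \<otimes> inv g)) = (if g = h then f h * of_nat (order G) else 0)"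
    if "g \<in> carrier G" for g using h that trace[of "h \<otimes> inv g"] by auto
  hence "(\<Sum>g\<in>carrier G. f g * mat_trace (\<rho> (h \<otimes> inv g))) = f h * of_nat (order G)"
    using finite_carrier h by simp
  thus ?thesis using rep_translate_orthogonal[OF f orth h rep] order_pos by simp
qed

lemma cf_inner_residual_eq_zero:
  assumes F: "finite F" "F \<subseteq> Irr G" and \<psi>: "\<psi> \<in> F"
  shows "cf_inner G (\<lambda>g. f g - (\<Sum>\<chi>\<in>F. cf_inner G f \<chi> * \<chi> g)) \<psi> = 0"
proof -
  have "(\<Sum>\<chi>\<in>F. cf_inner G f \<chi> * cf_inner G \<chi> \<psi>) = (\<Sum>\<chi>\<in>F. if \<chi> = \<psi> then cf_inner G f \<psi> else 0)"
    by (intro sum.cong refl) (use F \<psi> in \<open>auto simp: Irr_orthonormal subset_iff\<close>)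
  also have "\<dots> = cf_inner G f \<psi>" using F \<psi> by simp
  finally show ?thesis by (simp add: cf_inner_diff_left cf_inner_sum_left)
qed

lemma Bessel_inequality:
  assumes F: "finite F" "F \<subseteq> Irr G"
  shows "(\<Sum>\<chi>\<in>F. (norm (cf_inner G f \<chi>))\<^sup>2) \<le> Re (cf_inner G f f)"
proof -
  define s where "s = (\<lambda>g. \<Sum>\<chi>\<in>F. cf_inner G f \<chi> * \<chi> g)"
  define r where "r = (\<lambda>g. f g - s g)"
  have "cf_inner G r \<chi> = 0" if "\<chi> \<in> F" for \<chi>
    unfolding r_def s_def by (rule cf_inner_residual_eq_zero[OF F that])
  hence "cf_inner G \<chi> r = 0" if "\<chi> \<in> F" for \<chi> using that cnj_cf_inner[of G r \<chi>] by simp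
  hence "cf_inner G s r = 0" by (simp add: s_def cf_inner_sum_left)
  hence "cf_inner G r r = cf_inner G f r"
    using cf_inner_diff_left[of G f s r] by (simp add: r_def)
  also have "\<dots> = cnj (cf_inner G r f)" by (simp add: cnj_cf_inner)
  also have "cf_inner G r f = cf_inner G f f - (\<Sum>\<chi>\<in>F. cf_inner G f \<chi> * cf_inner G \<chi> f)"
    by (simp add: r_def s_def cf_inner_diff_left cf_inner_sum_left)
  also have "(\<Sum>\<chi>\<in>F. cf_inner G f \<chi> * cf_inner G \<chi> f) = of_real (\<Sum>\<chi>\<in>F. (norm (cf_inner G f \<chi>))\<^sup>2)"
    unfolding of_real_sum complex_norm_square cnj_cf_inner ..
  finally show ?thesis using Re_cf_inner_self_nonneg[of G r] by simp
qed

lemma norm_Irr_one_ge_1: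
  assumes "\<chi> \<in> Irr G"
  shows "norm (\<chi> \<one>) \<ge> 1"
proof -
  from assms obtain d \<rho> where irr: "is_irr_rep G d \<rho>" and "\<chi> = character G \<rho>" unfolding Irr_def by blast
  hence "\<chi> \<one> = of_nat d" by (simp add: character_def rep_one[OF irr_rep_is_rep[OF irr]])
  thus ?thesis using irr_rep_dim_pos[OF irr] by simp
qed

lemma finite_Irr: "finite (Irr G)"
proof -
  have "card F \<le> order G" if F: "F \<subseteq> Irr G" "finite F" for F
  proof -
    let ?\<delta> = "\<lambda>g. if g = \<one> then 1 else 0 :: complex" and ?N = "real (order G)"
    have \<delta>: "cf_inner G ?\<delta> \<alpha> = cnj (\<alpha> \<one>) / of_nat (order G)" for \<alpha>
      using finite_carrier by (simp add: cf_inner_def order_def if_distrib[of "\<lambda>x. x * _"] cong: if_cong)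
    have "real (card F) / ?N\<^sup>2 = (\<Sum>\<chi>\<in>F. 1 / ?N\<^sup>2)" by simp
    also have "\<dots> \<le> (\<Sum>\<chi>\<in>F. (norm (cf_inner G ?\<delta> \<chi>))\<^sup>2)"
      using F norm_Irr_one_ge_1
      by (intro sum_mono) (auto simp: \<delta> norm_divide power_divide intro!: divide_right_mono one_le_power)
    also have "\<dots> \<le> 1 / ?N"
      using Bessel_inequality[OF F(2,1), of ?\<delta>] by (simp add: \<delta> Re_divide_of_nat)
    finally show ?thesis using order_pos by (simp add: power2_eq_square divide_simps)
  qed
  thus ?thesis using finite_if_finite_subsets_card_bdd by blast
qed

theorem class_function_expansion:
  assumes f: "class_function f" and h: "h \<in> carrier G"
  shows "f h = (\<Sum>\<chi>\<in>Irr G. cf_inner G f \<chi> * \<chi> h)"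
proof -
  have "class_function (\<lambda>g. f g - (\<Sum>\<chi>\<in>Irr G. cf_inner G f \<chi> * \<chi> g))"
    unfolding class_function_def
    by (intro ballI arg_cong2[where f = "(-)"] sum.cong refl arg_cong2[where f = "(*)"]
        class_function_conjugate f is_character_class_function is_character_Irr)
  from class_function_eq_zero_if_orthogonal[OF this cf_inner_residual_eq_zero[OF finite_Irr subset_refl] h]
  show ?thesis by simp
qed

theorem column_orthogonality:
  assumes g: "g \<in> carrier G" and h: "h \<in> carrier G"
  shows "(\<Sum>\<chi>\<in>Irr G. \<chi> g * cnj (\<chi> h)) = (if g \<in> conj_class G h then of_nat (card (centralizer h)) else 0)"
proof -
  let ?K = "conj_class G h"
  define f :: "'a \<Rightarrow> complex" where "f x = (if x \<in> ?K then 1 else 0)" for x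
  have K: "?K \<subseteq> carrier G" "finite ?K"
    using conj_class_subset[OF h] finite_carrier finite_subset by auto
  have "class_function f"
  proof (rule class_functionI)
    fix x y assume xy: "x \<in> carrier G" "y \<in> carrier G" "y \<in> conj_class G x"
    hence "x \<in> ?K \<longleftrightarrow> y \<in> ?K"
      using conj_class_eq[OF xy(1,3)] conj_class_eq[OF h] conj_class_refl by metis
    thus "f y = f x" by (simp add: f_def)
  qed
  have "cf_inner G f \<chi> = cnj (\<chi> h) / of_nat (card (centralizer h))" if \<chi>: "\<chi> \<in> Irr G" for \<chi>
  proof -
    have "(\<Sum>x\<in>carrier G. f x * cnj (\<chi> x)) = (\<Sum>x\<in>?K. cnj (\<chi> x))"
      using K finite_carrier by (intro sum.mono_neutral_cong_right) (auto simp: f_def)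
    also have "\<dots> = of_nat (card ?K) * cnj (\<chi> h)"
      using class_function_eq[OF is_character_class_function[OF is_character_Irr[OF \<chi>]] h] by simp
    finally have "cf_inner G f \<chi> = of_nat (card ?K) * cnj (\<chi> h) / of_nat (card ?K * card (centralizer h))"
      by (simp add: cf_inner_def card_conj_class_times_centralizer[OF h] order_def)
    thus ?thesis using card_conj_class_pos[OF h] by simp
  qed
  hence "f g = (\<Sum>\<chi>\<in>Irr G. \<chi> g * cnj (\<chi> h)) / of_nat (card (centralizer h))"
    using class_function_expansion[OF \<open>class_function f\<close> g] by (simp add: sum_divide_distrib mult.commute)
  thus ?thesis using card_centralizer_pos[OF h] by (auto simp: f_def field_simps split: if_splits)
qed

end

section \<open>Classes of defect zero\<close>

lemma not_div_by_of_nat_iff: "not_div_by p (of_nat m) \<longleftrightarrow> \<not> p dvd m"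
proof -
  have "complex_of_nat m = of_int (int p * k) \<longleftrightarrow> int m = int p * k" for k
    by (metis of_int_eq_iff of_int_of_nat_eq)
  thus ?thesis unfolding not_div_by_def by (simp flip: dvd_def int_dvd_int_iff)
qed

context finite_group
begin

lemma sum_Irr_tuples:
  "(\<Sum>\<chi>\<in>Pi\<^sub>E {..<n} (\<lambda>_. Irr G). cf_inner G \<phi> (\<lambda>g. \<Prod>i<n. f (\<chi> i) g))
    = cf_inner G \<phi> (\<lambda>g. (\<Sum>\<chi>\<in>Irr G. f \<chi> g) ^ n)"
proof -
  have "(\<Sum>\<chi>\<in>Pi\<^sub>E {..<n} (\<lambda>_. Irr G). \<Prod>i<n. f (\<chi> i) g) = (\<Sum>\<chi>\<in>Irr G. f \<chi> g) ^ n" for g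
    using prod_sum_PiE[of "{..<n}" "\<lambda>_. Irr G" "\<lambda>_ \<chi>. f \<chi> g"] finite_Irr by simp
  thus ?thesis by (simp only: cf_inner_sum_right[symmetric])
qed

definition centralizer_weight :: "('a set \<Rightarrow> bool) \<Rightarrow> 'a \<Rightarrow> complex" where
  "centralizer_weight Q g = (if Q (conj_class G g) then of_nat (card (centralizer g)) else 0)"

lemma class_function_centralizer_weight_pow: "class_function (\<lambda>g. centralizer_weight Q g ^ n)"
  unfolding centralizer_weight_def
  by (rule class_function_combine[OF class_function_conj_class class_function_card_centralizer])

lemma gamma_n_eq: "gamma_n G n \<phi> = cf_inner G \<phi> (\<lambda>g. centralizer_weight (\<lambda>_. True) g ^ n)"
  unfolding gamma_n_def sum_Irr_tuples[where f = "\<lambda>\<chi> g. \<chi> g * cnj (\<chi> g)"]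
  by (rule cf_inner_cong) (simp_all add: column_orthogonality conj_class_refl centralizer_weight_def)

lemma delta_n_eq: "delta_n G n \<phi> = cf_inner G \<phi> (\<lambda>g. centralizer_weight (real_class G) g ^ n)"
proof -
  have "(\<Sum>\<chi>\<in>Irr G. (\<chi> g)\<^sup>2) = centralizer_weight (real_class G) g" if g: "g \<in> carrier G" for g
  proof -
    have "(\<Sum>\<chi>\<in>Irr G. (\<chi> g)\<^sup>2) = cnj (\<Sum>\<chi>\<in>Irr G. \<chi> (inv g) * cnj (\<chi> g))"
      by (simp add: is_character_inv[OF is_character_Irr g] power2_eq_square)
    also have "\<dots> = centralizer_weight (real_class G) g"
      using g by (simp add: column_orthogonality centralizer_weight_def real_class_iff)
    finally show ?thesis .
  qed
  thus ?thesis
    unfolding delta_n_def sum_Irr_tuples[where f = "\<lambda>\<chi> g. (\<chi> g)\<^sup>2"] by (intro cf_inner_cong) simp_all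
qed

lemma gamma_n_Ints: "\<phi> \<in> Irr G \<Longrightarrow> gamma_n G n \<phi> \<in> \<int>"
  unfolding gamma_n_def
  by (intro Ints_sum cf_inner_character_Ints is_character_prod is_character_mult is_character_cnj is_character_Irr)
    auto

lemma delta_n_Ints: "\<phi> \<in> Irr G \<Longrightarrow> delta_n G n \<phi> \<in> \<int>"
  unfolding delta_n_def power2_eq_square
  by (intro Ints_sum cf_inner_character_Ints is_character_prod is_character_mult is_character_Irr) auto

lemma cf_inner_centralizer_weight_div_cyclotomic:
  assumes \<phi>: "is_character \<phi>" and n: "n \<ge> 2" and p: "p > 0"
    and dvd: "\<And>g. g \<in> carrier G \<Longrightarrow> Q (conj_class G g) \<Longrightarrow> p dvd card (centralizer g)"
  shows "cf_inner G \<phi> (\<lambda>g. centralizer_weight Q g ^ n) / of_nat p \<in> cyclotomic_ints (order G)"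
proof -
  let ?c = "\<lambda>g. card (centralizer g)"
  define q where "q g = (if Q (conj_class G g) then int (?c g ^ (n - 1) div p) else 0)" for g
  define f where "f g = of_int (q g) * \<phi> g" for g
  have "class_function q"
    unfolding q_def
    by (rule class_function_combine[OF class_function_conj_class class_function_card_centralizer])
  hence "class_function f"
    unfolding f_def by (rule class_function_combine[OF _ is_character_class_function[OF \<phi>]])
  moreover have "f g \<in> cyclotomic_ints (order G)" if "g \<in> carrier G" for g
    unfolding f_def
    by (intro cyclotomic_ints_mult order_pos of_int_in_cyclotomic_ints is_character_cyclotomic \<phi> that)
  ultimately have "(\<Sum>g\<in>carrier G. of_nat (?c g) * f g) / of_nat (order G) \<in> cyclotomic_ints (order G)"
    by (rule average_centralizer_multiple_cyclotomic)
  also have "(\<Sum>g\<in>carrier G. of_nat (?c g) * f g)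
      = (\<Sum>g\<in>carrier G. \<phi> g * cnj (centralizer_weight Q g ^ n)) / of_nat p"
    unfolding sum_divide_distrib
  proof (rule sum.cong[OF refl])
    fix g assume g: "g \<in> carrier G"
    have "?c g * (?c g ^ (n - 1) div p) * p = ?c g ^ n" if "Q (conj_class G g)"
    proof -
      have "p dvd ?c g ^ (n - 1)" using dvd[OF g that] n by (intro dvd_power_le[of p _ 1, simplified]) auto
      hence "?c g * (?c g ^ (n - 1) div p) * p = ?c g * ?c g ^ (n - 1)" by simp
      also have "\<dots> = ?c g ^ n" using power_minus_mult[of n "?c g"] n by (simp add: mult.commute)
      finally show ?thesis .
    qed
    hence "of_nat (?c g) * of_nat (?c g ^ (n - 1) div p) * of_nat p = complex_of_nat (?c g) ^ n"
      if "Q (conj_class G g)" using that by (metis of_nat_mult of_nat_power)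
    thus "of_nat (?c g) * f g = \<phi> g * cnj (centralizer_weight Q g ^ n) / of_nat p"
      using n p by (auto simp: f_def q_def centralizer_weight_def field_simps)
  qed
  finally show ?thesis by (simp add: cf_inner_def order_def mult.commute)
qed

lemma centralizer_pow_div_cyclotomic:
  assumes h: "h \<in> carrier G" "Q (conj_class G h)"
    and int: "\<And>\<phi>. \<phi> \<in> Irr G \<Longrightarrow> cf_inner G \<phi> (\<lambda>g. centralizer_weight Q g ^ n) \<in> \<int>"
    and cyclotomic: "\<And>\<phi>. \<phi> \<in> Irr G \<Longrightarrow>
      cf_inner G \<phi> (\<lambda>g. centralizer_weight Q g ^ n) / of_nat p \<in> cyclotomic_ints (order G)"
  shows "of_nat (card (centralizer h) ^ n) / of_nat p \<in> cyclotomic_ints (order G)"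
proof -
  let ?F = "\<lambda>\<phi>. cf_inner G \<phi> (\<lambda>g. centralizer_weight Q g ^ n)"
  have real: "cnj (?F \<phi>) = ?F \<phi>" if "\<phi> \<in> Irr G" for \<phi>
    using int[OF that] by (metis Ints_cases complex_cnj_of_int)
  have "of_nat (card (centralizer h) ^ n) = centralizer_weight Q h ^ n"
    using h by (simp add: centralizer_weight_def)
  also have "\<dots> = (\<Sum>\<phi>\<in>Irr G. cnj (?F \<phi>) * \<phi> h)"
    unfolding cnj_cf_inner by (rule class_function_expansion[OF class_function_centralizer_weight_pow h(1)])
  also have "\<dots> = (\<Sum>\<phi>\<in>Irr G. ?F \<phi> * \<phi> h)"
    by (intro sum.cong refl) (simp only: real)
  finally have "of_nat (card (centralizer h) ^ n) / of_nat p = (\<Sum>\<phi>\<in>Irr G. ?F \<phi> / of_nat p * \<phi> h)"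
    by (simp add: sum_divide_distrib)
  also have "\<dots> \<in> cyclotomic_ints (order G)"
    using h
    by (intro cyclotomic_ints_sum cyclotomic_ints_mult order_pos cyclotomic is_character_cyclotomic is_character_Irr)
  finally show ?thesis .
qed

theorem defect_zero_class_iff:
  assumes p: "prime p" and n: "n \<ge> 2"
    and int: "\<And>\<phi>. \<phi> \<in> Irr G \<Longrightarrow> cf_inner G \<phi> (\<lambda>g. centralizer_weight Q g ^ n) \<in> \<int>"
  shows "(\<exists>K. is_conj_class G K \<and> Q K \<and> p_defect_zero G p K)
    \<longleftrightarrow> (\<exists>\<phi>\<in>Irr G. not_div_by p (cf_inner G \<phi> (\<lambda>g. centralizer_weight Q g ^ n)))"
proof -
  have p_pos: "p > 0" using p by (rule prime_gt_0_nat)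
  note not_div_by_iff = not_div_by_iff_cyclotomic_ints[OF p_pos order_pos]
  have "(\<exists>K. is_conj_class G K \<and> Q K \<and> p_defect_zero G p K)
      \<longleftrightarrow> (\<exists>g\<in>carrier G. Q (conj_class G g) \<and> \<not> p dvd card (centralizer g))"
    unfolding is_conj_class_def using p_defect_zero_iff[OF p] by blast
  also have "\<dots> \<longleftrightarrow> (\<exists>\<phi>\<in>Irr G. not_div_by p (cf_inner G \<phi> (\<lambda>g. centralizer_weight Q g ^ n)))"
  proof
    assume "\<exists>g\<in>carrier G. Q (conj_class G g) \<and> \<not> p dvd card (centralizer g)"
    then obtain h where h: "h \<in> carrier G" "Q (conj_class G h)" and "\<not> p dvd card (centralizer h)" by blast
    hence "\<not> p dvd card (centralizer h) ^ n" using p prime_dvd_power by blast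
    hence "of_nat (card (centralizer h) ^ n) / of_nat p \<notin> cyclotomic_ints (order G)"
      unfolding not_div_by_iff[OF Ints_of_nat, symmetric] not_div_by_of_nat_iff .
    thus "\<exists>\<phi>\<in>Irr G. not_div_by p (cf_inner G \<phi> (\<lambda>g. centralizer_weight Q g ^ n))"
      using centralizer_pow_div_cyclotomic[OF h int] not_div_by_iff[OF int] by blast
  next
    assume "\<exists>\<phi>\<in>Irr G. not_div_by p (cf_inner G \<phi> (\<lambda>g. centralizer_weight Q g ^ n))"
    thus "\<exists>g\<in>carrier G. Q (conj_class G g) \<and> \<not> p dvd card (centralizer g)"
      using cf_inner_centralizer_weight_div_cyclotomic[OF is_character_Irr n p_pos] not_div_by_iff[OF int] by blast
  qed
  finally show ?thesis .
qed

end

theorem theorem4: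
  fixes G :: "('a, 'b) monoid_scheme" and p n :: nat
  assumes "group G" and "finite (carrier G)" and "prime p" and "n \<ge> 2"
  shows "((\<exists>K. is_conj_class G K \<and> p_defect_zero G p K) \<longleftrightarrow>
            (\<exists>\<phi> \<in> Irr G. not_div_by p (gamma_n G n \<phi>)))
       \<and> ((\<exists>K. is_conj_class G K \<and> real_class G K \<and> p_defect_zero G p K) \<longleftrightarrow>
            (\<exists>\<phi> \<in> Irr G. not_div_by p (delta_n G n \<phi>)))"
proof
  interpret finite_group G using assms(1,2) by (simp add: finite_group_def finite_group_axioms_def)
  show "(\<exists>K. is_conj_class G K \<and> p_defect_zero G p K) \<longleftrightarrow> (\<exists>\<phi>\<in>Irr G. not_div_by p (gamma_n G n \<phi>))"
    using defect_zero_class_iff[OF assms(3,4) gamma_n_Ints[unfolded gamma_n_eq]] by (simp add: gamma_n_eq)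
  show "(\<exists>K. is_conj_class G K \<and> real_class G K \<and> p_defect_zero G p K)
      \<longleftrightarrow> (\<exists>\<phi>\<in>Irr G. not_div_by p (delta_n G n \<phi>))"
    using defect_zero_class_iff[OF assms(3,4) delta_n_Ints[unfolded delta_n_eq]] by (simp add: delta_n_eq)
qed

end
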